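(* There is a universal constant $c>0$ such that the following holds. Let $X=\{x_1,\ldots,x_n\}\subseteq\mathbb{R}^d$ be a finite set and $\varepsilon\in(0,1)$. Then there exist an integer $m\le c\,\varepsilon^{-2}\log n$ and a terminal embedding $f\colon\mathbb{R}^d\to\mathbb{R}^{m+1}$ of $X$ with distortion $\varepsilon$ such that $f$ is locally $\tfrac12$-Hölder almost everywhere: for (Lebesgue) almost every $u\in\mathbb{R}^d$ there exist an open neighborhood $U$ of $u$ and a constant $D_u>0$ with \[\|f(v)-f(w)\|\le D_u\|v-w\|^{1/2}\quad\forall\,v,w\in U.\] More precisely, this local $\tfrac12$-Hölder property holds at every $u\in\mathbb{R}^d\setminus X$ that has a unique nearest point in $X$.
   Context: All norms are Euclidean. For $X\subseteq\mathbb{R}^d$ and $\varepsilon\in(0,1)$, a map $f\colon\mathbb{R}^d\to\mathbb{R}^{k}$ is a terminal embedding of $X$ with distortion $\varepsilon$ if $(1-\varepsilon)\|x-y\|\le\|f(x)-f(y)\|\le(1+\varepsilon)\|x-y\|$ for all $x\in X$ and all $y\in\mathbb{R}^d$. *)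

theory Defs
  imports "HOL-Analysis.Analysis"
begin

text \<open>Euclidean space R^d with the dimension d as an explicit natural number
  (needed because the constant c must be uniform in d).  Points of R^d are
  functions on the index set {..<d} (extensional, as in PiE).\<close>

definition euclid :: "nat \<Rightarrow> (nat \<Rightarrow> real) set" where
  "euclid d = PiE {..<d} (\<lambda>_. UNIV)"

definition enorm :: "nat \<Rightarrow> (nat \<Rightarrow> real) \<Rightarrow> real" where
  "enorm d x = sqrt (\<Sum>i<d. (x i)\<^sup>2)"

definition edist :: "nat \<Rightarrow> (nat \<Rightarrow> real) \<Rightarrow> (nat \<Rightarrow> real) \<Rightarrow> real" where
  "edist d x y = enorm d (\<lambda>i. x i - y i)"

definition lebesgue_d :: "nat \<Rightarrow> (nat \<Rightarrow> real) measure" where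
  "lebesgue_d d = PiM {..<d} (\<lambda>_. lborel)"

definition terminal_embedding ::
  "nat \<Rightarrow> nat \<Rightarrow> (nat \<Rightarrow> real) set \<Rightarrow> real \<Rightarrow> ((nat \<Rightarrow> real) \<Rightarrow> (nat \<Rightarrow> real)) \<Rightarrow> bool" where
  "terminal_embedding d k X eps f \<longleftrightarrow>
     (\<forall>y\<in>euclid d. f y \<in> euclid k) \<and>
     (\<forall>x\<in>X. \<forall>y\<in>euclid d.
        (1 - eps) * edist d x y \<le> edist k (f x) (f y) \<and>
        edist k (f x) (f y) \<le> (1 + eps) * edist d x y)"

definition locally_half_hoelder_at ::
  "nat \<Rightarrow> nat \<Rightarrow> ((nat \<Rightarrow> real) \<Rightarrow> (nat \<Rightarrow> real)) \<Rightarrow> (nat \<Rightarrow> real) \<Rightarrow> bool" where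
  "locally_half_hoelder_at d k f u \<longleftrightarrow>
     (\<exists>r>0. \<exists>D>0. \<forall>v\<in>euclid d. \<forall>w\<in>euclid d.
        edist d u v < r \<longrightarrow> edist d u w < r \<longrightarrow>
        edist k (f v) (f w) \<le> D * (edist d v w) powr (1/2))"

definition unique_nearest :: "nat \<Rightarrow> (nat \<Rightarrow> real) set \<Rightarrow> (nat \<Rightarrow> real) \<Rightarrow> bool" where
  "unique_nearest d X u \<longleftrightarrow> (\<exists>!x. x \<in> X \<and> (\<forall>y\<in>X. edist d u x \<le> edist d u y))"

end

theory Submission
  imports Defs "HOL-Library.Function_Algebras"
begin

text \<open>Let \<open>T\<close> be the set of normalised differences of points of \<open>X\<close>. The linear map \<open>\<Pi>\<close> is a
  scaled random sign matrix. By the lower tail bound and a union bound over the \<open>|T| ^ N\<close> sums \<open>z\<close>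
  of \<open>N\<close> elements of \<open>T\<close>, \<open>|\<Pi> z|^2 \<ge> (1 - sqrt N \<delta>) |z|^2\<close> for all such sums and all
  \<open>N \<le> 1/\<delta>^2\<close>. Averaging this over random sums (Maurey) is exact for quadratic forms up to a
  variance term, so choosing \<open>N\<close> of order \<open>1/|z|^2\<close> gives \<open>|\<Pi> z| \<ge> |z| - 5 \<delta>\<close> on the convex hull
  of \<open>T\<close>, with no logarithmic loss and no chaining; only this one-sided bound is needed.

  By duality the hull bound yields, for each \<open>x0\<close> in \<open>X\<close> and each unit vector \<open>w\<close>, a vector \<open>\<zeta>\<close>
  in the unit ball whose inner products with the vectors \<open>\<Pi> (x - x0) / |x - x0|\<close> agree up to
  \<open>6 \<delta>\<close> with those of \<open>w\<close> with \<open>(x - x0) / |x - x0|\<close>. Taking \<open>\<zeta>\<close> as the minimiser of a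
  strongly convex penalty makes it Lipschitz in \<open>w\<close>. If \<open>x0\<close> is a nearest point of \<open>u\<close> and
  \<open>w = u - x0\<close>, the embedding maps \<open>u\<close> to \<open>(\<Pi> x0 + g w, sqrt (|w|^2 - |g w|^2))\<close> with
  \<open>g w = |w| \<zeta> (w / |w|)\<close>; the square root costs the exponent \<open>1/2\<close>. Points without a
  unique nearest point lie on finitely many hyperplanes.\<close>

subsection \<open>Functions on an index set as vectors\<close>

text \<open>Adds scalars to the pointwise addition on functions, so that \<open>linear\<close> and
  the generic sum lemmas apply while the dimension stays a natural number.\<close>

instantiation "fun" :: (type, real_vector) real_vector
begin

definition scaleR_fun_def: "r *\<^sub>R f = (\<lambda>x. r *\<^sub>R f x)"

instance
  by standard (auto simp: scaleR_fun_def fun_eq_iff scaleR_add_right scaleR_add_left)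

end

lemma scaleR_fun_apply [simp]: "(r *\<^sub>R f) x = r *\<^sub>R f x"
  by (simp add: scaleR_fun_def)

text \<open>Only semidefinite on functions: coordinates from \<open>d\<close> on are ignored, so
  identities need no carrier conditions.\<close>

definition dot :: "nat \<Rightarrow> (nat \<Rightarrow> real) \<Rightarrow> (nat \<Rightarrow> real) \<Rightarrow> real" where
  "dot d x y = (\<Sum>i<d. x i * y i)"

lemma dot_commute: "dot d x y = dot d y x"
  by (simp add: dot_def mult.commute)

lemma dot_add_left: "dot d (x + y) z = dot d x z + dot d y z"
  and dot_add_right: "dot d z (x + y) = dot d z x + dot d z y"
  and dot_diff_left: "dot d (x - y) z = dot d x z - dot d y z"
  and dot_diff_right: "dot d z (x - y) = dot d z x - dot d z y"
  and dot_minus_left: "dot d (- x) z = - dot d x z"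
  and dot_minus_right: "dot d z (- x) = - dot d z x"
  by (simp_all add: dot_def algebra_simps sum.distrib sum_subtractf sum_negf)

lemma dot_scaleR_left: "dot d (r *\<^sub>R x) z = r * dot d x z"
  and dot_scaleR_right: "dot d z (r *\<^sub>R x) = r * dot d z x"
  by (simp_all add: dot_def sum_distrib_left algebra_simps)

lemma dot_zero [simp]: "dot d 0 z = 0" "dot d z 0 = 0"
  by (simp_all add: dot_def)

lemmas dot_linear = dot_add_left dot_add_right dot_diff_left dot_diff_right
  dot_minus_left dot_minus_right dot_scaleR_left dot_scaleR_right

lemma dot_sum_right: "dot d z (\<Sum>i\<in>I. f i) = (\<Sum>i\<in>I. dot d z (f i))"
  by (induction I rule: infinite_finite_induct) (simp_all only: sum.infinite sum.empty sum.insert dot_zero dot_linear not_False_eq_True simp_thms)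

lemma dot_self_nonneg [simp]: "0 \<le> dot d x x"
  by (auto simp: dot_def intro!: sum_nonneg)

lemma dot_cong: "(\<And>i. i < d \<Longrightarrow> x i = x' i) \<Longrightarrow> (\<And>i. i < d \<Longrightarrow> y i = y' i) \<Longrightarrow> dot d x y = dot d x' y'"
  by (simp add: dot_def)

lemma enorm_eq_sqrt_dot: "enorm d x = sqrt (dot d x x)"
  by (simp add: enorm_def dot_def power2_eq_square)

lemma enorm_square: "(enorm d x)\<^sup>2 = dot d x x"
  by (simp add: enorm_eq_sqrt_dot)

lemma enorm_nonneg [simp]: "0 \<le> enorm d x"
  by (simp add: enorm_eq_sqrt_dot)

lemma enorm_eq_L2: "enorm d x = L2_set x {..<d}"
  by (simp add: enorm_def L2_set_def)

lemma enorm_triangle: "enorm d (x + y) \<le> enorm d x + enorm d y"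
  using L2_set_triangle_ineq[of x y "{..<d}"] by (simp add: enorm_eq_L2 plus_fun_def)

lemma enorm_scaleR [simp]: "enorm d (r *\<^sub>R x) = \<bar>r\<bar> * enorm d x"
  by (simp add: enorm_eq_sqrt_dot dot_linear real_sqrt_mult mult.assoc[symmetric])

lemma enorm_minus [simp]: "enorm d (- x) = enorm d x"
  by (simp add: enorm_eq_sqrt_dot dot_linear)

lemma enorm_zero [simp]: "enorm d 0 = 0"
  by (simp add: enorm_eq_sqrt_dot)

lemma enorm_minus_commute: "enorm d (x - y) = enorm d (y - x)"
  using enorm_minus[of d "x - y"] by simp

lemma enorm_reverse_triangle: "\<bar>enorm d x - enorm d y\<bar> \<le> enorm d (x - y)"
  using enorm_triangle[of d "x - y" y] enorm_triangle[of d "y - x" x]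
  by (simp add: enorm_minus_commute[of d y x])

lemma enorm_eq_0_iff: "enorm d x = 0 \<longleftrightarrow> (\<forall>i<d. x i = 0)"
  by (auto simp: enorm_def sum_nonneg_eq_0_iff)

lemma edist_eq: "edist d x y = enorm d (x - y)"
  by (simp add: edist_def fun_diff_def)

lemma dot_Cauchy_Schwarz: "\<bar>dot d x y\<bar> \<le> enorm d x * enorm d y"
proof -
  have "\<bar>dot d x y\<bar> \<le> (\<Sum>i<d. \<bar>x i\<bar> * \<bar>y i\<bar>)"
    unfolding dot_def by (rule order_trans[OF sum_abs]) (simp add: abs_mult)
  also have "\<dots> \<le> enorm d x * enorm d y"
    using L2_set_mult_ineq[of x y "{..<d}"] by (simp add: enorm_eq_L2)
  finally show ?thesis .
qed

subsection \<open>Averages over random signs\<close>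

text \<open>Expectation over \<open>d\<close> independent uniform signs, conditioned on the last one
  so that moment bounds go by induction on the dimension.\<close>

primrec sign_mean :: "nat \<Rightarrow> ((nat \<Rightarrow> real) \<Rightarrow> real) \<Rightarrow> real" where
  "sign_mean 0 F = F 0"
| "sign_mean (Suc d) F = (sign_mean d (\<lambda>s. F (s(d := 1))) + sign_mean d (\<lambda>s. F (s(d := - 1)))) / 2"

lemma sign_mean_mono: "(\<And>s. F s \<le> G s) \<Longrightarrow> sign_mean d F \<le> sign_mean d G"
  by (induction d arbitrary: F G) (auto intro!: divide_right_mono add_mono)

lemma sign_mean_const [simp]: "sign_mean d (\<lambda>s. c) = c"
  by (induction d) auto

lemma sign_mean_add: "sign_mean d (\<lambda>s. F s + G s) = sign_mean d F + sign_mean d G"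
  by (induction d arbitrary: F G) (auto simp: field_simps)

lemma sign_mean_cmult: "sign_mean d (\<lambda>s. c * F s) = c * sign_mean d F"
  by (induction d arbitrary: F) (auto simp: field_simps)

lemma sign_mean_sum: "sign_mean d (\<lambda>s. \<Sum>j\<in>J. F j s) = (\<Sum>j\<in>J. sign_mean d (F j))"
  by (induction J rule: infinite_finite_induct) (auto simp: sign_mean_add)

lemma sign_mean_attained: "\<exists>s. F s \<le> sign_mean d F"
proof (induction d arbitrary: F)
  case 0
  then show ?case by auto
next
  case (Suc d)
  obtain s t where "F (s(d := 1)) \<le> sign_mean d (\<lambda>s. F (s(d := 1)))"
    "F (t(d := - 1)) \<le> sign_mean d (\<lambda>s. F (s(d := - 1)))"
    using Suc by meson
  then have "F (s(d := 1)) \<le> sign_mean (Suc d) F \<or> F (t(d := - 1)) \<le> sign_mean (Suc d) F"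
    by auto
  then show ?case by blast
qed

text \<open>The method of conditional expectations, one row at a time.\<close>

lemma derandomize_rows:
  assumes "finite J"
  shows "\<exists>S. (\<Sum>j\<in>J. c j * (\<Prod>k<m. h j (S k))) \<le> (\<Sum>j\<in>J. c j * sign_mean d (h j) ^ m)"
proof (induction m arbitrary: c)
  case 0
  then show ?case by simp
next
  case (Suc m)
  obtain s where s: "(\<Sum>j\<in>J. (c j * sign_mean d (h j) ^ m) * h j s)
      \<le> sign_mean d (\<lambda>s. \<Sum>j\<in>J. (c j * sign_mean d (h j) ^ m) * h j s)"
    using sign_mean_attained[of "\<lambda>s. \<Sum>j\<in>J. (c j * sign_mean d (h j) ^ m) * h j s" d] by blast
  obtain S where S: "(\<Sum>j\<in>J. (c j * h j s) * (\<Prod>k<m. h j (S k)))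
      \<le> (\<Sum>j\<in>J. (c j * h j s) * sign_mean d (h j) ^ m)"
    using Suc[of "\<lambda>j. c j * h j s"] by blast
  have "(\<Sum>j\<in>J. c j * (\<Prod>k<Suc m. h j ((S(m := s)) k)))
      = (\<Sum>j\<in>J. (c j * h j s) * (\<Prod>k<m. h j (S k)))"
    by (intro sum.cong refl) (simp add: mult_ac)
  also note S
  also have "(\<Sum>j\<in>J. (c j * h j s) * sign_mean d (h j) ^ m)
      = (\<Sum>j\<in>J. (c j * sign_mean d (h j) ^ m) * h j s)"
    by (simp add: mult_ac)
  also note s
  also have "sign_mean d (\<lambda>s. \<Sum>j\<in>J. (c j * sign_mean d (h j) ^ m) * h j s)
      = (\<Sum>j\<in>J. c j * sign_mean d (h j) ^ Suc m)"
    by (simp only: sign_mean_sum sign_mean_cmult power_Suc2 mult.assoc)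
  finally show ?case by blast
qed

text \<open>Union bound by exponential moments: \<open>h j\<close> is a penalty whose product over
  the rows is at least 1 when the bad event \<open>j\<close> occurs. Independent rows give it the
  mean \<open>sign_mean d (h j) ^ m\<close>, and in a nonnegative sum below 1 every term is below
  1.\<close>

lemma sign_matrix_exists:
  assumes J: "finite J" and h: "\<And>j s. j \<in> J \<Longrightarrow> 0 \<le> h j s"
    and less: "(\<Sum>j\<in>J. sign_mean d (h j) ^ m) < 1"
  shows "\<exists>S. \<forall>j\<in>J. (\<Prod>k<m. h j (S k)) < (1::real)"
proof -
  obtain S where S: "(\<Sum>j\<in>J. 1 * (\<Prod>k<m. h j (S k))) \<le> (\<Sum>j\<in>J. 1 * sign_mean d (h j) ^ m)"
    using derandomize_rows[OF J, where c = "\<lambda>_. 1" and m = m and h = h and d = d] by blast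
  have "(\<Prod>k<m. h j (S k)) < 1" if "j \<in> J" for j
  proof -
    have "(\<Prod>k<m. h j (S k)) \<le> (\<Sum>j\<in>J. \<Prod>k<m. h j (S k))"
      by (rule member_le_sum) (use that J h in \<open>auto intro!: prod_nonneg\<close>)
    then show ?thesis using S less by simp
  qed
  then show ?thesis by blast
qed

section \<open>Moments and exponential moments of one random sign sum\<close>

lemma dot_Suc_fun_upd: "dot (Suc d) (s(d := c)) z = dot d s z + c * z d"
  by (simp add: dot_def)

lemma dot_Suc: "dot (Suc d) x z = dot d x z + x d * z d"
  by (simp add: dot_def)

lemma sign_mean_square: "sign_mean d (\<lambda>s. (dot d s z)\<^sup>2) = dot d z z"
proof (induction d)
  case 0
  then show ?case by (simp add: dot_def)
next
  case (Suc d)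
  have "sign_mean (Suc d) (\<lambda>s. (dot (Suc d) s z)\<^sup>2)
      = sign_mean d (\<lambda>s. (1/2) * ((dot d s z + z d)\<^sup>2 + (dot d s z - z d)\<^sup>2))"
    by (simp only: sign_mean.simps dot_Suc_fun_upd sign_mean_add sign_mean_cmult) simp
  also have "\<dots> = sign_mean d (\<lambda>s. (dot d s z)\<^sup>2 + (z d)\<^sup>2)"
    by (simp add: power2_eq_square algebra_simps)
  finally show ?case
    using Suc by (simp only: sign_mean_add sign_mean_const dot_Suc) (simp add: power2_eq_square)
qed

text \<open>Averaging over the last sign kills the odd powers, and the induction step has a slack of
  \<open>2 * z d ^ 4\<close>; so the Gaussian constant 3 persists.\<close>

lemma sign_mean_fourth_power: "sign_mean d (\<lambda>s. (dot d s z) ^ 4) \<le> 3 * (dot d z z)\<^sup>2"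
proof (induction d)
  case 0
  then show ?case by (simp add: dot_def)
next
  case (Suc d)
  have "sign_mean (Suc d) (\<lambda>s. (dot (Suc d) s z) ^ 4)
      = sign_mean d (\<lambda>s. (1/2) * ((dot d s z + z d) ^ 4 + (dot d s z - z d) ^ 4))"
    by (simp only: sign_mean.simps dot_Suc_fun_upd sign_mean_add sign_mean_cmult) simp
  also have "\<dots> = sign_mean d (\<lambda>s. (dot d s z) ^ 4 + ((6 * (z d)\<^sup>2) * (dot d s z)\<^sup>2 + z d ^ 4))"
    by (intro arg_cong[where f = "sign_mean d"] ext) algebra
  also have "\<dots> \<le> 3 * (dot d z z)\<^sup>2 + (6 * (z d)\<^sup>2 * dot d z z + z d ^ 4)"
    using Suc by (simp add: sign_mean_add sign_mean_cmult sign_mean_square)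
  also have "\<dots> \<le> 3 * (dot (Suc d) z z)\<^sup>2"
    using zero_le_even_power[of 4 "z d"]
    by (simp add: dot_Suc power2_eq_square algebra_simps power4_eq_xxxx)
  finally show ?case .
qed

text \<open>The product of \<open>1 + x + x^2/2\<close> and \<open>1 - x + x^2/2\<close> is
  \<open>1 + x^4/4\<close>, and the first factor is at most \<open>exp x\<close>.\<close>

lemma exp_minus_le_quadratic:
  assumes "0 \<le> (x::real)"
  shows "exp (- x) \<le> 1 - x + x\<^sup>2 / 2"
proof -
  have pos: "0 < 1 + x + x\<^sup>2 / 2" using assms by (simp add: add_pos_nonneg)
  have "1 \<le> (1 + x + x\<^sup>2 / 2) * (1 - x + x\<^sup>2 / 2)"
    using zero_le_even_power[of 4 x] by (simp add: algebra_simps power2_eq_square power4_eq_xxxx)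
  then have "inverse (1 + x + x\<^sup>2 / 2) \<le> 1 - x + x\<^sup>2 / 2"
    using pos by (simp add: field_simps)
  moreover have "exp (- x) \<le> inverse (1 + x + x\<^sup>2 / 2)"
    unfolding exp_minus using exp_lower_Taylor_quadratic[OF assms] pos by (intro le_imp_inverse_le)
  ultimately show ?thesis by linarith
qed

text \<open>Lower tail. The exponent is nonpositive, so a quadratic Taylor bound holds for every
  \<open>t \<ge> 0\<close>, and the second and fourth moments suffice.\<close>

lemma sign_mean_exp_neg_square:
  assumes "0 \<le> t"
  shows "sign_mean d (\<lambda>s. exp (- (t * (dot d s z)\<^sup>2)))
    \<le> exp (- (t * dot d z z) + 3/2 * t\<^sup>2 * (dot d z z)\<^sup>2)"
proof -
  have "sign_mean d (\<lambda>s. exp (- (t * (dot d s z)\<^sup>2)))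
      \<le> sign_mean d (\<lambda>s. 1 + ((- t) * (dot d s z)\<^sup>2 + t\<^sup>2 / 2 * (dot d s z) ^ 4))"
  proof (rule sign_mean_mono)
    fix s
    show "exp (- (t * (dot d s z)\<^sup>2)) \<le> 1 + ((- t) * (dot d s z)\<^sup>2 + t\<^sup>2 / 2 * (dot d s z) ^ 4)"
      using exp_minus_le_quadratic[of "t * (dot d s z)\<^sup>2"] assms
      by (simp add: power_mult_distrib)
  qed
  also have "\<dots> = 1 + ((- t) * dot d z z + t\<^sup>2 / 2 * sign_mean d (\<lambda>s. (dot d s z) ^ 4))"
    by (simp only: sign_mean_add sign_mean_cmult sign_mean_square sign_mean_const)
  also have "\<dots> \<le> 1 + ((- t) * dot d z z + t\<^sup>2 / 2 * (3 * (dot d z z)\<^sup>2))"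
    by (intro add_left_mono mult_left_mono sign_mean_fourth_power) auto
  also have "\<dots> = 1 + (- (t * dot d z z) + 3/2 * t\<^sup>2 * (dot d z z)\<^sup>2)"
    by simp
  also have "\<dots> \<le> exp (- (t * dot d z z) + 3/2 * t\<^sup>2 * (dot d z z)\<^sup>2)"
    by (rule exp_ge_add_one_self)
  finally show ?thesis .
qed

text \<open>In logarithms: \<open>x^2/2 - ln (cosh x)\<close> vanishes at 0 and has derivative
  \<open>x - tanh x\<close>, nonnegative for \<open>x \<ge> 0\<close>.\<close>

lemma cosh_le_exp_half_square: "(exp x + exp (- x)) / 2 \<le> exp (x\<^sup>2 / 2)" for x :: real
proof -
  have tanh_le: "tanh x \<le> x" if "0 \<le> x" for x :: real
  proof -
    have "x - tanh x \<ge> 0 - tanh 0"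
      by (rule DERIV_nonneg_imp_nondecreasing[OF that])
        (auto intro!: exI derivative_eq_intros simp: less_imp_neq[OF cosh_real_pos, symmetric])
    then show ?thesis by simp
  qed
  have main: "cosh x \<le> exp (x\<^sup>2 / 2)" if "0 \<le> x" for x :: real
  proof -
    have "x\<^sup>2 / 2 - ln (cosh x) \<ge> 0\<^sup>2 / 2 - ln (cosh 0)"
    proof (rule DERIV_nonneg_imp_nondecreasing[OF that])
      fix y :: real assume "0 \<le> y"
      have "((\<lambda>x. x\<^sup>2 / 2 - ln (cosh x)) has_real_derivative y - tanh y) (at y)"
        by (auto intro!: derivative_eq_intros simp: tanh_def cosh_real_pos)
      then show "\<exists>D. ((\<lambda>x. x\<^sup>2 / 2 - ln (cosh x)) has_real_derivative D) (at y) \<and> 0 \<le> D"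
        using tanh_le[OF \<open>0 \<le> y\<close>] by auto
    qed
    then have "exp (ln (cosh x)) \<le> exp (x\<^sup>2 / 2)" by (subst exp_le_cancel_iff) simp
    then show ?thesis by (subst (asm) exp_ln) (auto simp: cosh_real_pos)
  qed
  have "cosh x \<le> exp (x\<^sup>2 / 2)"
    using main[of x] main[of "- x"] by (cases "0 \<le> x") auto
  then show ?thesis by (simp add: cosh_field_def)
qed

text \<open>The right side is the exact mean of \<open>exp (t * (a + v * G)^2)\<close> for a
  standard Gaussian \<open>G\<close>: a sign is dominated by a Gaussian of equal variance.\<close>

lemma sign_average_exp_square:
  fixes a v t :: real
  assumes "0 \<le> t" "2 * t * v\<^sup>2 < 1"
  shows "(exp (t * (a + v)\<^sup>2) + exp (t * (a - v)\<^sup>2)) / 2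
    \<le> 1 / sqrt (1 - 2 * t * v\<^sup>2) * exp (t / (1 - 2 * t * v\<^sup>2) * a\<^sup>2)"
proof -
  define x where "x = 2 * t * v\<^sup>2"
  have x: "0 \<le> x" "x < 1" using assms by (auto simp: x_def)
  have "(exp (t * (a + v)\<^sup>2) + exp (t * (a - v)\<^sup>2)) / 2
      = exp (t * a\<^sup>2 + t * v\<^sup>2) * ((exp (2 * t * a * v) + exp (- (2 * t * a * v))) / 2)"
    by (simp add: exp_add[symmetric] distrib_left power2_eq_square algebra_simps)
  also have "\<dots> \<le> exp (t * a\<^sup>2 + t * v\<^sup>2) * exp ((2 * t * a * v)\<^sup>2 / 2)"
    by (intro mult_left_mono cosh_le_exp_half_square) auto
  also have "\<dots> = exp (x / 2) * exp (t * (1 + x) * a\<^sup>2)"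
    by (simp add: exp_add[symmetric] x_def power2_eq_square algebra_simps)
  also have "\<dots> \<le> 1 / sqrt (1 - x) * exp (t / (1 - x) * a\<^sup>2)"
  proof (intro mult_mono)
    have "1 - x \<le> exp (- x)" using exp_ge_add_one_self[of "- x"] by simp
    then have "sqrt (1 - x) \<le> sqrt (exp (- x))" by (rule real_sqrt_le_mono)
    also have "sqrt (exp (- x)) = exp (- x / 2)"
      by (rule real_sqrt_unique) (auto simp: power2_eq_square exp_add[symmetric])
    finally have "sqrt (1 - x) * exp (x / 2) \<le> exp (- x / 2) * exp (x / 2)"
      by (intro mult_right_mono) auto
    also have "\<dots> = 1" by (simp add: exp_add[symmetric])
    finally show "exp (x / 2) \<le> 1 / sqrt (1 - x)"
      using x by (simp add: field_simps)
    have "(1 + x) * (1 - x) \<le> 1" by (simp add: algebra_simps)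
    then have "1 + x \<le> 1 / (1 - x)" using x by (simp add: field_simps)
    then have "t * (1 + x) \<le> t * (1 / (1 - x))" using assms(1) by (intro mult_left_mono)
    then show "exp (t * (1 + x) * a\<^sup>2) \<le> exp (t / (1 - x) * a\<^sup>2)"
      using mult_right_mono[of "t * (1 + x)" "t * (1 / (1 - x))" "a\<^sup>2"] by simp
  qed (use x in auto)
  finally show ?thesis by (simp add: x_def)
qed

text \<open>The shift \<open>a\<close> absorbs the last sign, so the induction hypothesis applies to
  the others; the Gaussian form of the bound is stable under this.\<close>

lemma sign_mean_exp_shifted_square:
  assumes "0 \<le> t" "2 * t * dot d z z < 1"
  shows "sign_mean d (\<lambda>s. exp (t * (a + dot d s z)\<^sup>2))
    \<le> 1 / sqrt (1 - 2 * t * dot d z z) * exp (t / (1 - 2 * t * dot d z z) * a\<^sup>2)"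
  using assms
proof (induction d arbitrary: a)
  case 0
  then show ?case by (simp add: dot_def)
next
  case (Suc d)
  define u where "u = 1 - 2 * t * dot d z z"
  define v where "v = z d"
  have S: "dot (Suc d) z z = dot d z z + v\<^sup>2" by (simp add: dot_Suc v_def power2_eq_square)
  have tv: "0 \<le> t * v\<^sup>2" using Suc.prems by simp
  have u: "2 * t * v\<^sup>2 < u" using Suc.prems(2) unfolding S u_def by (simp add: algebra_simps)
  then have upos: "0 < u" using tv by linarith
  have IH: "sign_mean d (\<lambda>s. exp (t * (b + dot d s z)\<^sup>2)) \<le> 1 / sqrt u * exp (t / u * b\<^sup>2)" for b
    using Suc.IH[of b] Suc.prems(1) upos unfolding u_def by simp
  have "sign_mean (Suc d) (\<lambda>s. exp (t * (a + dot (Suc d) s z)\<^sup>2))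
      = (sign_mean d (\<lambda>s. exp (t * ((a + v) + dot d s z)\<^sup>2))
         + sign_mean d (\<lambda>s. exp (t * ((a - v) + dot d s z)\<^sup>2))) / 2"
    by (simp add: dot_Suc_fun_upd v_def algebra_simps)
  also have "\<dots> \<le> (1 / sqrt u * exp (t / u * (a + v)\<^sup>2) + 1 / sqrt u * exp (t / u * (a - v)\<^sup>2)) / 2"
    by (intro divide_right_mono add_mono IH) auto
  also have "\<dots> = 1 / sqrt u * ((exp (t / u * (a + v)\<^sup>2) + exp (t / u * (a - v)\<^sup>2)) / 2)"
    by (simp only: times_divide_eq_right distrib_left)
  also have "\<dots> \<le> 1 / sqrt u * (1 / sqrt (1 - 2 * (t / u) * v\<^sup>2)
      * exp ((t / u) / (1 - 2 * (t / u) * v\<^sup>2) * a\<^sup>2))"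
    using upos u Suc.prems(1)
    by (intro mult_left_mono sign_average_exp_square) (auto simp: field_simps)
  also have "\<dots> = 1 / sqrt (u * (1 - 2 * (t / u) * v\<^sup>2))
      * exp (t / (u * (1 - 2 * (t / u) * v\<^sup>2)) * a\<^sup>2)"
    by (simp add: real_sqrt_mult)
  also have "u * (1 - 2 * (t / u) * v\<^sup>2) = 1 - 2 * t * dot (Suc d) z z"
    unfolding S using upos by (simp add: field_simps) (simp add: u_def algebra_simps)
  finally show ?case .
qed

text \<open>Upper tail. The prefactor is absorbed by \<open>ln (1 - y) \<ge> - y - 2 * y^2\<close>
  at \<open>y = 2 * t\<close>, valid for \<open>y \<le> 1/2\<close>.\<close>

lemma sign_mean_exp_square:
  assumes "dot d z z = 1" "0 \<le> t" "t \<le> 1/4"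
  shows "sign_mean d (\<lambda>s. exp (t * (dot d s z)\<^sup>2)) \<le> exp (t + 4 * t\<^sup>2)"
proof -
  have pos: "0 < 1 - 2 * t" using assms by simp
  have "- (2 * t) - 2 * (2 * t)\<^sup>2 \<le> ln (1 - 2 * t)"
    using ln_one_minus_pos_lower_bound[of "2 * t"] assms by simp
  then have "exp (- (2 * t) - 2 * (2 * t)\<^sup>2) \<le> 1 - 2 * t"
    using pos by (simp add: ln_ge_iff)
  then have "sqrt (exp (- (2 * t) - 2 * (2 * t)\<^sup>2)) \<le> sqrt (1 - 2 * t)"
    by (rule real_sqrt_le_mono)
  also have "sqrt (exp (- (2 * t) - 2 * (2 * t)\<^sup>2)) = exp (- (t + 4 * t\<^sup>2))"
    by (rule real_sqrt_unique) (auto simp: power2_eq_square exp_add[symmetric] algebra_simps)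
  finally have "exp (- (t + 4 * t\<^sup>2)) * exp (t + 4 * t\<^sup>2) \<le> sqrt (1 - 2 * t) * exp (t + 4 * t\<^sup>2)"
    by (intro mult_right_mono) auto
  then have "1 \<le> sqrt (1 - 2 * t) * exp (t + 4 * t\<^sup>2)"
    by (simp add: exp_add[symmetric])
  then have "1 / sqrt (1 - 2 * t) \<le> exp (t + 4 * t\<^sup>2)"
    using pos by (simp add: field_simps)
  then show ?thesis
    using sign_mean_exp_shifted_square[of t d z 0] assms by simp
qed

subsection \<open>Distortion of a random sign matrix on a convex hull\<close>

lemma enorm_sum: "enorm d (\<Sum>i\<in>I. f i) \<le> (\<Sum>i\<in>I. enorm d (f i))"
proof (induction I rule: infinite_finite_induct)
  case (insert i I)
  then show ?case
    using enorm_triangle[of d "f i" "\<Sum>i\<in>I. f i"] unfolding sum.insert[OF insert.hyps] by linarith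
qed (simp_all add: enorm_def)

lemma sum_quarter_powers: "(\<Sum>N=1..M. (1/4::real) ^ N) \<le> 1/3"
proof -
  have "(\<Sum>N=1..M. (1/4::real) ^ N) = (1 - (1/4) ^ M) / 3"
  proof (induction M)
    case (Suc M)
    have "(\<Sum>N=1..Suc M. (1/4::real) ^ N) = (\<Sum>N=1..M. (1/4) ^ N) + (1/4) ^ Suc M" by simp
    then show ?case unfolding Suc by simp
  qed simp
  then show ?thesis by simp
qed

text \<open>A sum of \<open>N\<close> elements, a list to allow repetitions, may lose the factor
  \<open>1 - sqrt N * \<delta>\<close>. It then fails with probability at most
  \<open>exp (- m * \<delta>^2 / 6) ^ N\<close>, which beats the \<open>card T ^ N\<close> choices,
  so the union bound over all \<open>N\<close> is a geometric series.\<close>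

lemma sign_matrix_distortion:
  assumes T: "finite T" "\<And>v. v \<in> T \<Longrightarrow> dot d v v = 1" "card T \<le> n\<^sup>2" and n: "2 \<le> n"
    and \<delta>: "0 < \<delta>" "\<delta> < 1" and m: "64 * ln (real n) \<le> real m * \<delta>\<^sup>2"
  shows "\<exists>S. (\<forall>v\<in>T. (\<Sum>k<m. (dot d (S k) v)\<^sup>2) \<le> (1 + \<delta>) * real m)
    \<and> (\<forall>xs. set xs \<subseteq> T \<longrightarrow> real (length xs) * \<delta>\<^sup>2 \<le> 1 \<longrightarrow>
        (1 - sqrt (real (length xs)) * \<delta>) * real m * dot d (sum_list xs) (sum_list xs)
        \<le> (\<Sum>k<m. (dot d (S k) (sum_list xs))\<^sup>2))"
proof -
  define M where "M = nat \<lfloor>1 / \<delta>\<^sup>2\<rfloor>"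
  define L where "L N = {xs. set xs \<subseteq> T \<and> length xs = N}" for N :: nat
  define q where "q xs = dot d (sum_list xs) (sum_list xs)" for xs
  define \<eta> where "\<eta> N = sqrt (real N) * \<delta>" for N
  \<comment> \<open>Minimises \<open>- \<eta> * y + 3/2 * y^2\<close> over \<open>y = t * q\<close>;
    the optimum \<open>y = \<eta> / 3\<close> gives the exponent
    \<open>- \<eta>^2 / 6\<close>.\<close>
  define t where "t xs = \<eta> (length xs) / (3 * q xs)" for xs
  \<comment> \<open>A zero sum satisfies its bound trivially, so its penalty is 0.\<close>
  define low where "low = (\<lambda>(N::nat, xs) s. if q xs = 0 then 0
    else exp (t xs * ((1 - \<eta> (length xs)) * q xs - (dot d s (sum_list xs))\<^sup>2)))"
  \<comment> \<open>The rate \<open>\<delta> / 8\<close> minimises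
    \<open>- y * \<delta> + 4 * y^2\<close>, giving the exponent
    \<open>- \<delta>^2 / 16\<close>.\<close>
  define up where "up v s = exp (\<delta> / 8 * ((dot d s v)\<^sup>2 - (1 + \<delta>)))" for v s
  define J where "J = (Sigma {1..M} L) <+> T"
  have finL: "finite (L N)" for N
    unfolding L_def using finite_lists_length_eq[OF T(1)] .
  have cardL: "card (L N) = card T ^ N" for N
    unfolding L_def using card_lists_length_eq[OF T(1)] .
  have finJ: "finite J" using finL T(1) by (simp add: J_def)
  have lnn: "0 < ln (real n)" using n by simp
  have exp4: "real n ^ 4 * exp (- (4 * ln (real n))) = 1"
  proof -
    have "exp (4 * ln (real n)) = real n ^ 4"
      using n exp_of_nat_mult[of 4 "ln (real n)"] by simp
    then show ?thesis using n by (simp add: exp_minus)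
  qed
  \<comment> \<open>Source of the constant 64: \<open>64 / 16 = 4\<close> and
    \<open>64 / 6 \<ge> 4\<close> make both tail factors at most \<open>n^-4\<close>, which against
    \<open>card T \<le> n^2\<close> leaves \<open>n^-2 \<le> 1/4\<close>. The two union bounds then
    add up to at most \<open>1/3 + 1/4\<close>.\<close>
  have quarter: "real (card T) * r \<le> 1/4" if "0 \<le> r" "r \<le> exp (- (4 * ln (real n)))" for r
  proof -
    have "real (card T) * r \<le> (real n)\<^sup>2 * exp (- (4 * ln (real n)))"
      using that T(3) by (intro mult_mono) (auto simp flip: of_nat_power)
    also have "\<dots> \<le> 1/4"
    proof -
      have "4 * ((real n)\<^sup>2 * exp (- (4 * ln (real n)))) \<le> (real n)\<^sup>2 * ((real n)\<^sup>2 * exp (- (4 * ln (real n))))"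
        using n power_mono[of 2 "real n" 2] by (intro mult_right_mono) auto
      also have "\<dots> = 1" using exp4 by (simp add: power2_eq_square power4_eq_xxxx mult.assoc)
      finally show ?thesis by simp
    qed
    finally show ?thesis .
  qed
  have mean_low: "sign_mean d (low (N, xs)) \<le> exp (- (\<eta> N)\<^sup>2 / 6)" if "xs \<in> L N" for N xs
  proof (cases "q xs = 0")
    case True
    then show ?thesis by (simp add: low_def)
  next
    case False
    have len: "length xs = N" using that by (simp add: L_def)
    have qpos: "0 < q xs" using False dot_self_nonneg[of d "sum_list xs"] unfolding q_def by linarith
    have t0: "0 \<le> t xs" using qpos \<delta> by (simp add: t_def \<eta>_def)
    have tq: "t xs * q xs = \<eta> N / 3" using qpos by (simp add: t_def len)
    have "sign_mean d (low (N, xs))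
        = sign_mean d (\<lambda>s. exp (t xs * ((1 - \<eta> N) * q xs)) * exp (- (t xs * (dot d s (sum_list xs))\<^sup>2)))"
      using False by (simp add: low_def len exp_add[symmetric] right_diff_distrib)
    also have "\<dots> \<le> exp (t xs * ((1 - \<eta> N) * q xs)) * exp (- (t xs * q xs) + 3/2 * (t xs)\<^sup>2 * (q xs)\<^sup>2)"
      unfolding sign_mean_cmult q_def
      by (intro mult_left_mono sign_mean_exp_neg_square t0) auto
    also have "\<dots> = exp ((1 - \<eta> N) * (t xs * q xs) - t xs * q xs + 3/2 * (t xs * q xs)\<^sup>2)"
      by (simp add: exp_add[symmetric] power_mult_distrib mult_ac)
    also have "\<dots> = exp (- (\<eta> N)\<^sup>2 / 6)"
      unfolding tq by (simp add: power2_eq_square field_simps)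
    finally show ?thesis .
  qed
  have mean_up: "sign_mean d (up v) \<le> exp (- \<delta>\<^sup>2 / 16)" if "v \<in> T" for v
  proof -
    have "sign_mean d (up v) = exp (- (\<delta> / 8 * (1 + \<delta>))) * sign_mean d (\<lambda>s. exp (\<delta> / 8 * (dot d s v)\<^sup>2))"
      unfolding sign_mean_cmult[symmetric] up_def
      by (simp add: exp_add[symmetric] algebra_simps)
    also have "\<dots> \<le> exp (- (\<delta> / 8 * (1 + \<delta>))) * exp (\<delta> / 8 + 4 * (\<delta> / 8)\<^sup>2)"
      by (intro mult_left_mono sign_mean_exp_square T(2)) (use \<delta> that in auto)
    also have "\<dots> = exp (- \<delta>\<^sup>2 / 16)"
      by (simp add: exp_add[symmetric] power2_eq_square field_simps)
    finally show ?thesis .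
  qed
  have nonneg_low: "0 \<le> low p s" for p s by (simp add: low_def split: prod.splits)
  have nonneg_up: "0 \<le> up v s" for v s by (simp add: up_def)
  have mean_nonneg: "0 \<le> sign_mean d F" if "\<And>s. 0 \<le> F s" for F
    using sign_mean_mono[of "\<lambda>_. 0" F d] that by simp
  have "(\<Sum>p\<in>Sigma {1..M} L. sign_mean d (low p) ^ m) = (\<Sum>N=1..M. \<Sum>xs\<in>L N. sign_mean d (low (N, xs)) ^ m)"
    using finL by (subst sum.Sigma) auto
  also have "\<dots> \<le> (\<Sum>N=1..M. \<Sum>xs\<in>L N. exp (- (real m * \<delta>\<^sup>2) / 6) ^ N)"
  proof (intro sum_mono)
    fix N xs assume "xs \<in> L N"
    then have "sign_mean d (low (N, xs)) ^ m \<le> exp (- (\<eta> N)\<^sup>2 / 6) ^ m"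
      by (intro power_mono mean_low mean_nonneg nonneg_low)
    also have "\<dots> = exp (- (real m * \<delta>\<^sup>2) / 6) ^ N"
      by (simp add: \<eta>_def exp_of_nat_mult[symmetric] power_mult_distrib)
    finally show "sign_mean d (low (N, xs)) ^ m \<le> exp (- (real m * \<delta>\<^sup>2) / 6) ^ N" .
  qed
  also have "\<dots> = (\<Sum>N=1..M. (real (card T) * exp (- (real m * \<delta>\<^sup>2) / 6)) ^ N)"
    by (simp add: cardL power_mult_distrib)
  also have "\<dots> \<le> (\<Sum>N=1..M. (1/4) ^ N)"
  proof (intro sum_mono power_mono quarter)
    show "exp (- (real m * \<delta>\<^sup>2) / 6) \<le> exp (- (4 * ln (real n)))"
      using m lnn by simp
  qed auto
  also note sum_quarter_powers
  finally have A: "(\<Sum>p\<in>Sigma {1..M} L. sign_mean d (low p) ^ m) \<le> 1/3" .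
  have "(\<Sum>v\<in>T. sign_mean d (up v) ^ m) \<le> (\<Sum>v\<in>T. exp (- \<delta>\<^sup>2 / 16) ^ m)"
    by (intro sum_mono power_mono mean_up mean_nonneg nonneg_up)
  also have "\<dots> = real (card T) * exp (- (real m * \<delta>\<^sup>2) / 16)"
    by (simp add: exp_of_nat_mult[symmetric])
  also have "\<dots> \<le> 1/4"
    using m by (intro quarter) auto
  finally have B: "(\<Sum>v\<in>T. sign_mean d (up v) ^ m) \<le> 1/4" .
  have "(\<Sum>j\<in>J. sign_mean d ((case_sum low up) j) ^ m)
      = (\<Sum>p\<in>Sigma {1..M} L. sign_mean d (low p) ^ m) + (\<Sum>v\<in>T. sign_mean d (up v) ^ m)"
    unfolding J_def using finL T(1) by (subst sum.Plus) auto
  then have "(\<Sum>j\<in>J. sign_mean d ((case_sum low up) j) ^ m) < 1" using A B by simp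
  then obtain S where S: "\<And>j. j \<in> J \<Longrightarrow> (\<Prod>k<m. case_sum low up j (S k)) < 1"
    using sign_matrix_exists[of J "case_sum low up" d m] finJ nonneg_low nonneg_up
    by (fastforce split: sum.splits)
  have "(\<Sum>k<m. (dot d (S k) v)\<^sup>2) \<le> (1 + \<delta>) * real m" if "v \<in> T" for v
  proof -
    have "(\<Prod>k<m. up v (S k)) < 1" using S[of "Inr v"] that by (simp add: J_def InrI)
    then have "exp (\<Sum>k<m. \<delta> / 8 * ((dot d (S k) v)\<^sup>2 - (1 + \<delta>))) < 1"
      by (simp add: up_def exp_sum)
    then have "\<delta> / 8 * (\<Sum>k<m. (dot d (S k) v)\<^sup>2 - (1 + \<delta>)) < 0"
      by (simp only: sum_distrib_left exp_less_one_iff)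
    then have "(\<Sum>k<m. (dot d (S k) v)\<^sup>2 - (1 + \<delta>)) < 0"
      using \<delta> by (simp add: mult_less_0_iff)
    then show ?thesis by (simp add: sum_subtractf mult.commute)
  qed
  moreover have "(1 - \<eta> (length xs)) * real m * q xs \<le> (\<Sum>k<m. (dot d (S k) (sum_list xs))\<^sup>2)"
    if xs: "set xs \<subseteq> T" "real (length xs) * \<delta>\<^sup>2 \<le> 1" for xs
  proof (cases "q xs = 0")
    case True
    then show ?thesis by (simp add: sum_nonneg)
  next
    case False
    then have ne: "xs \<noteq> []" by (auto simp: q_def)
    have qpos: "0 < q xs" using False dot_self_nonneg[of d "sum_list xs"] unfolding q_def by linarith
    have tpos: "0 < t xs" using qpos \<delta> ne by (simp add: t_def \<eta>_def)
    have "real (length xs) \<le> 1 / \<delta>\<^sup>2" using xs(2) \<delta> by (simp add: field_simps)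
    then have "length xs \<le> M" unfolding M_def by (simp add: le_nat_floor)
    then have "(length xs, xs) \<in> Sigma {1..M} L" using xs(1) ne by (auto simp: L_def Suc_le_eq)
    then have "(\<Prod>k<m. low (length xs, xs) (S k)) < 1"
      using S[of "Inl (length xs, xs)"] unfolding J_def by (auto simp only: sum.case InlI)
    then have "exp (\<Sum>k<m. t xs * ((1 - \<eta> (length xs)) * q xs - (dot d (S k) (sum_list xs))\<^sup>2)) < 1"
      using False by (simp add: low_def exp_sum)
    then have "t xs * (\<Sum>k<m. (1 - \<eta> (length xs)) * q xs - (dot d (S k) (sum_list xs))\<^sup>2) < 0"
      by (simp only: sum_distrib_left exp_less_one_iff)
    then have "(\<Sum>k<m. (1 - \<eta> (length xs)) * q xs - (dot d (S k) (sum_list xs))\<^sup>2) < 0"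
      using tpos by (simp add: mult_less_0_iff)
    then show ?thesis by (simp add: sum_subtractf mult_ac)
  qed
  ultimately show ?thesis unfolding \<eta>_def q_def by blast
qed

text \<open>Maurey's empirical averaging: the conclusion is the expectation of \<open>h\<close> at \<open>a\<close> plus the sum of
  \<open>N\<close> independent samples \<open>v i\<close> drawn with probabilities \<open>p i\<close>.\<close>

lemma maurey_quadratic:
  fixes h :: "'a::real_vector \<Rightarrow> real"
  assumes h: "\<And>x y. h (x + y) = h x + B x y + h y" and B: "\<And>x. linear (B x)"
    and p: "finite I" "\<And>i. i \<in> I \<Longrightarrow> 0 \<le> p i" "(\<Sum>i\<in>I. p i) = 1" "\<And>i. i \<in> I \<Longrightarrow> v i \<in> T"
    and z: "z = (\<Sum>i\<in>I. p i *\<^sub>R v i)"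
    and pos: "\<And>xs. set xs \<subseteq> T \<Longrightarrow> length xs = N \<Longrightarrow> 0 \<le> h (a + sum_list xs)"
  shows "0 \<le> h (a + real N *\<^sub>R z) + real N * ((\<Sum>i\<in>I. p i * h (v i)) - h z)"
  using pos
proof (induction N arbitrary: a)
  case 0
  then show ?case using "0"[of "[]"] by simp
next
  case (Suc N)
  define V where "V = (\<Sum>i\<in>I. p i * h (v i)) - h z"
  define b where "b = a + real N *\<^sub>R z"
  \<comment> \<open>Condition on one sample: its value moves into the shift, and the induction
    hypothesis covers the other \<open>N\<close> samples.\<close>
  have "0 \<le> h (b + v i) + real N * V" if "i \<in> I" for i
  proof -
    have "0 \<le> h ((a + v i) + real N *\<^sub>R z) + real N * V"
      unfolding V_def
    proof (rule Suc.IH)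
      fix xs assume "set xs \<subseteq> T" "length xs = N"
      then show "0 \<le> h (a + v i + sum_list xs)"
        using Suc.prems[of "v i # xs"] p(4)[OF that] by (simp add: add.assoc)
    qed
    then show ?thesis by (simp add: b_def algebra_simps)
  qed
  then have "0 \<le> (\<Sum>i\<in>I. p i * (h (b + v i) + real N * V))"
    using p(2) by (intro sum_nonneg mult_nonneg_nonneg) auto
  also have "\<dots> = (\<Sum>i\<in>I. p i * h b) + (\<Sum>i\<in>I. p i * B b (v i)) + (\<Sum>i\<in>I. p i * h (v i)) + (\<Sum>i\<in>I. p i * (real N * V))"
    by (simp add: h algebra_simps sum.distrib)
  also have "\<dots> = h b + B b z + (\<Sum>i\<in>I. p i * h (v i)) + real N * V"
    unfolding sum_distrib_right[symmetric] p(3) z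
    by (simp add: linear_sum[OF B] linear_cmul[OF B])
  also have "\<dots> = h (b + z) + real (Suc N) * V"
    by (simp add: h V_def algebra_simps)
  also have "b + z = a + real (Suc N) *\<^sub>R z"
    by (simp add: b_def algebra_simps)
  finally show ?case unfolding V_def .
qed

section \<open>From finite sums of directions to their convex hull\<close>

definition mat_vec :: "nat \<Rightarrow> (nat \<Rightarrow> nat \<Rightarrow> real) \<Rightarrow> (nat \<Rightarrow> real) \<Rightarrow> nat \<Rightarrow> real" where
  "mat_vec d R z = (\<lambda>k. dot d (R k) z)"

lemma mat_vec_add: "mat_vec d R (x + y) = mat_vec d R x + mat_vec d R y"
  and mat_vec_diff: "mat_vec d R (x - y) = mat_vec d R x - mat_vec d R y"
  and mat_vec_scaleR: "mat_vec d R (r *\<^sub>R x) = r *\<^sub>R mat_vec d R x"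
  by (auto simp: mat_vec_def dot_linear fun_eq_iff)

lemma mat_vec_zero [simp]: "mat_vec d R 0 = 0"
  by (simp add: mat_vec_def fun_eq_iff)

lemma mat_vec_sum: "mat_vec d R (\<Sum>i\<in>I. f i) = (\<Sum>i\<in>I. mat_vec d R (f i))"
proof (induction I rule: infinite_finite_induct)
  case (insert i I)
  then show ?case by (simp only: sum.insert[OF insert.hyps] mat_vec_add)
qed (simp_all add: mat_vec_def fun_eq_iff dot_def)

text \<open>Maurey's averaging applies to \<open>h x = |R x|^2 - (1 - \<eta>) * |x|^2\<close>,
  nonnegative on sums of \<open>N\<close> elements of \<open>T\<close>, and yields
  \<open>h z \<ge> - (\<delta> + \<eta>) / (N - 1)\<close>. With \<open>N\<close> near
  \<open>1 / |z|^2\<close> and \<open>\<eta> * |z| \<le> 2 * \<delta>\<close>, the loss in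
  \<open>|R z|^2\<close> is at most \<open>5 * \<delta> * |z|\<close>.\<close>

lemma hull_lower_bound:
  assumes T: "\<And>v. v \<in> T \<Longrightarrow> dot d v v = 1" and \<delta>: "0 < \<delta>"
    and up: "\<And>v. v \<in> T \<Longrightarrow> dot m (mat_vec d R v) (mat_vec d R v) \<le> 1 + \<delta>"
    and low: "\<And>xs. set xs \<subseteq> T \<Longrightarrow> real (length xs) * \<delta>\<^sup>2 \<le> 1 \<Longrightarrow>
        (1 - sqrt (real (length xs)) * \<delta>) * dot d (sum_list xs) (sum_list xs)
        \<le> dot m (mat_vec d R (sum_list xs)) (mat_vec d R (sum_list xs))"
    and p: "finite I" "\<And>i. i \<in> I \<Longrightarrow> 0 \<le> p i" "(\<Sum>i\<in>I. p i) = 1" "\<And>i. i \<in> I \<Longrightarrow> v i \<in> T"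
    and z: "z = (\<Sum>i\<in>I. p i *\<^sub>R v i)"
  shows "enorm d z \<le> enorm m (mat_vec d R z) + 5 * \<delta>"
proof (cases "enorm d z \<le> 5 * \<delta>")
  case True
  then show ?thesis using enorm_nonneg[of m "mat_vec d R z"] by linarith
next
  case False
  \<comment> \<open>In this case \<open>\<rho> > 5 * \<delta>\<close>, which keeps
    \<open>N \<le> 3 / \<rho>^2\<close> within the range \<open>N * \<delta>^2 \<le> 1\<close> of
    \<open>low\<close>.\<close>
  define \<rho> where "\<rho> = enorm d z"
  have \<rho>: "5 * \<delta> < \<rho>" "0 < \<rho>" using False \<delta> by (auto simp: \<rho>_def)
  have "\<rho> \<le> (\<Sum>i\<in>I. enorm d (p i *\<^sub>R v i))" unfolding \<rho>_def z by (rule enorm_sum)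
  also have "\<dots> = (\<Sum>i\<in>I. p i)"
    by (intro sum.cong refl) (use p T in \<open>auto simp: enorm_eq_sqrt_dot dot_linear real_sqrt_mult\<close>)
  finally have \<rho>1: "\<rho> \<le> 1" using p(3) by simp
  then have \<rho>2: "\<rho>\<^sup>2 \<le> \<rho>" "\<rho>\<^sup>2 \<le> 1" using \<rho> by (simp_all add: power2_eq_square mult_left_le_one_le mult_le_one)
  \<comment> \<open>The extra 1 ensures \<open>N - 1 \<ge> 1 / \<rho>^2\<close>; the final estimate
    divides by \<open>N - 1\<close>.\<close>
  define N where "N = nat \<lceil>1 / \<rho>\<^sup>2\<rceil> + 1"
  have N1: "1 / \<rho>\<^sup>2 \<le> real N - 1" unfolding N_def by (simp add: of_nat_nat real_nat_ceiling_ge)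
  have "real N \<le> 1 / \<rho>\<^sup>2 + 2"
    unfolding N_def using ceiling_correct[of "1 / \<rho>\<^sup>2"] \<rho> by (simp add: of_nat_nat)
  moreover have "2 \<le> 2 / \<rho>\<^sup>2" using \<rho> \<rho>2(2) by (subst pos_le_divide_eq) auto
  moreover have "1 / \<rho>\<^sup>2 + 2 / \<rho>\<^sup>2 = 3 / \<rho>\<^sup>2" by simp
  ultimately have N3: "real N \<le> 3 / \<rho>\<^sup>2" by linarith
  have "25 * \<delta>\<^sup>2 \<le> \<rho>\<^sup>2" using power_mono[of "5 * \<delta>" \<rho> 2] \<rho> \<delta> by (simp add: power_mult_distrib)
  then have "3 * \<delta>\<^sup>2 \<le> \<rho>\<^sup>2" using zero_le_power2[of \<delta>] by linarith
  then have "3 / \<rho>\<^sup>2 * \<delta>\<^sup>2 \<le> 1" using \<rho>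
    by (simp only: times_divide_eq_left) (simp add: pos_divide_le_eq)
  then have N\<delta>: "real N * \<delta>\<^sup>2 \<le> 1"
    using mult_right_mono[OF N3, of "\<delta>\<^sup>2"] by simp
  define \<eta> where "\<eta> = sqrt (real N) * \<delta>"
  have "sqrt (real N) \<le> sqrt (4 / \<rho>\<^sup>2)"
    using N3 \<rho> by (intro real_sqrt_le_mono) (auto elim!: order_trans intro!: divide_right_mono)
  also have "\<dots> = 2 / \<rho>" using \<rho> by (simp add: real_sqrt_divide)
  finally have \<eta>: "\<eta> * \<rho> \<le> 2 * \<delta>"
    unfolding \<eta>_def using \<rho> \<delta> by (simp add: field_simps)
  have \<eta>0: "0 \<le> \<eta>" unfolding \<eta>_def using \<delta> by simp
  define h where "h x = dot m (mat_vec d R x) (mat_vec d R x) - (1 - \<eta>) * dot d x x" for x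
  define B where "B x y = 2 * dot m (mat_vec d R x) (mat_vec d R y) - (1 - \<eta>) * (2 * dot d x y)" for x y
  have "0 \<le> h (0 + real N *\<^sub>R z) + real N * ((\<Sum>i\<in>I. p i * h (v i)) - h z)"
  proof (rule maurey_quadratic[where B = B and T = T, OF _ _ p z])
    show "h (x + y) = h x + B x y + h y" for x y
      by (simp add: h_def B_def mat_vec_add dot_linear dot_commute[of m "mat_vec d R y" "mat_vec d R x"]
        dot_commute[of d y x] algebra_simps)
    show "linear (B x)" for x
      by (rule linearI) (simp_all add: B_def mat_vec_add mat_vec_scaleR dot_linear algebra_simps)
    show "0 \<le> h (0 + sum_list xs)" if "set xs \<subseteq> T" "length xs = N" for xs
      using low[of xs] that N\<delta> by (simp add: h_def \<eta>_def)
  qed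
  moreover have "h (0 + real N *\<^sub>R z) = (real N)\<^sup>2 * h z"
    by (simp add: h_def mat_vec_scaleR dot_linear algebra_simps power2_eq_square)
  moreover have "(\<Sum>i\<in>I. p i * h (v i)) \<le> \<delta> + \<eta>"
  proof -
    have "(\<Sum>i\<in>I. p i * h (v i)) \<le> (\<Sum>i\<in>I. p i * (\<delta> + \<eta>))"
    proof (intro sum_mono mult_left_mono)
      fix i assume "i \<in> I"
      then show "h (v i) \<le> \<delta> + \<eta>" using up[of "v i"] T[of "v i"] p(4)[of i] by (simp add: h_def)
    qed (use p in auto)
    then show ?thesis by (simp add: sum_distrib_right[symmetric] p(3))
  qed
  then have "real N * (\<Sum>i\<in>I. p i * h (v i)) \<le> real N * (\<delta> + \<eta>)"
    by (intro mult_left_mono) auto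
  ultimately have "0 \<le> real N * ((real N - 1) * h z + (\<delta> + \<eta>))"
    by (simp add: algebra_simps power2_eq_square)
  moreover have Npos: "0 < real N" unfolding N_def by (subst of_nat_0_less_iff) simp
  ultimately have hz: "0 \<le> (real N - 1) * h z + (\<delta> + \<eta>)" by (simp add: zero_le_mult_iff)
  have "- ((\<delta> + \<eta>) * \<rho>\<^sup>2) \<le> h z"
  proof (rule ccontr)
    assume "\<not> ?thesis"
    then have less: "h z < - ((\<delta> + \<eta>) * \<rho>\<^sup>2)" by simp
    have N0: "0 < real N - 1" using N1 \<rho> by (meson divide_pos_pos less_le_trans zero_less_one zero_less_power)
    have "(real N - 1) * h z < (real N - 1) * (- ((\<delta> + \<eta>) * \<rho>\<^sup>2))"
      using less N0 by (rule mult_strict_left_mono)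
    also have "\<dots> \<le> 1 / \<rho>\<^sup>2 * (- ((\<delta> + \<eta>) * \<rho>\<^sup>2))"
      using N1 \<delta> \<eta>0 by (intro mult_right_mono_neg) auto
    also have "\<dots> = - (\<delta> + \<eta>)" using \<rho> by simp
    finally show False using hz by simp
  qed
  then have "\<rho>\<^sup>2 - 2 * (\<eta> * \<rho>) * \<rho> - \<delta> * \<rho>\<^sup>2 \<le> dot m (mat_vec d R z) (mat_vec d R z)"
    unfolding h_def \<rho>_def enorm_square[symmetric] by (simp add: algebra_simps power2_eq_square)
  moreover have "2 * (\<eta> * \<rho>) * \<rho> \<le> 4 * \<delta> * \<rho>" using \<eta> \<rho> by (intro mult_right_mono) auto
  moreover have "\<delta> * \<rho>\<^sup>2 \<le> \<delta> * \<rho>" using \<rho>2 \<delta> by simp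
  \<comment> \<open>Here \<open>\<rho> > 5 * \<delta>\<close> trades the loss in the square for an
    additive loss in the norm.\<close>
  moreover have "(\<rho> - 5 * \<delta>)\<^sup>2 \<le> \<rho>\<^sup>2 - 5 * \<delta> * \<rho>"
  proof -
    have "5 * \<delta> * (5 * \<delta>) \<le> 5 * \<delta> * \<rho>" using \<rho> \<delta> by (intro mult_left_mono) auto
    then show ?thesis by (simp add: power2_eq_square algebra_simps)
  qed
  ultimately have "(\<rho> - 5 * \<delta>)\<^sup>2 \<le> (enorm m (mat_vec d R z))\<^sup>2" by (simp add: enorm_square)
  then have "\<rho> - 5 * \<delta> \<le> enorm m (mat_vec d R z)" by (rule power2_le_imp_le) simp
  then show ?thesis by (simp add: \<rho>_def)
qed

text \<open>Symmetry of \<open>T\<close> moves the signs of the coefficients into the vectors, and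
  division by the l1 norm of \<open>c\<close> reduces to convex combinations; hence the error is
  proportional to that norm.\<close>

lemma convex_hull_distortion_exists:
  fixes T :: "(nat \<Rightarrow> real) set"
  assumes T: "finite T" "\<And>v. v \<in> T \<Longrightarrow> dot d v v = 1" "card T \<le> n\<^sup>2" "\<And>v. v \<in> T \<Longrightarrow> - v \<in> T"
    and n: "2 \<le> n"
    and \<delta>: "0 < \<delta>" "\<delta> < 1" and m: "64 * ln (real n) \<le> real m * \<delta>\<^sup>2"
  shows "\<exists>R. (\<forall>v\<in>T. \<bar>dot m (mat_vec d R v) (mat_vec d R v) - 1\<bar> \<le> \<delta>)
    \<and> (\<forall>(I :: 'i set) c v. finite I \<longrightarrow> v ` I \<subseteq> T \<longrightarrow>
        enorm d (\<Sum>i\<in>I. c i *\<^sub>R v i)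
        \<le> enorm m (mat_vec d R (\<Sum>i\<in>I. c i *\<^sub>R v i)) + 5 * \<delta> * (\<Sum>i\<in>I. \<bar>c i\<bar>))"
proof -
  obtain S where
    up: "\<And>v. v \<in> T \<Longrightarrow> (\<Sum>k<m. (dot d (S k) v)\<^sup>2) \<le> (1 + \<delta>) * real m" and
    low: "\<And>xs. set xs \<subseteq> T \<Longrightarrow> real (length xs) * \<delta>\<^sup>2 \<le> 1 \<Longrightarrow>
        (1 - sqrt (real (length xs)) * \<delta>) * real m * dot d (sum_list xs) (sum_list xs)
        \<le> (\<Sum>k<m. (dot d (S k) (sum_list xs))\<^sup>2)"
    using sign_matrix_distortion[OF T(1-3) n \<delta> m] by blast
  have "0 < ln (real n)" using n by simp
  then have mpos: "0 < real m" using m \<delta> by (cases "m = 0") auto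
  define R where "R k = (1 / sqrt (real m)) *\<^sub>R S k" for k
  have Q: "dot m (mat_vec d R z) (mat_vec d R z) = (\<Sum>k<m. (dot d (S k) z)\<^sup>2) / real m" for z
    unfolding dot_def[of m] mat_vec_def R_def
    by (simp add: dot_linear sum_divide_distrib power2_eq_square)
  have up': "dot m (mat_vec d R v) (mat_vec d R v) \<le> 1 + \<delta>" if "v \<in> T" for v
    using up[OF that] mpos by (simp add: Q field_simps)
  have low': "(1 - sqrt (real (length xs)) * \<delta>) * dot d (sum_list xs) (sum_list xs)
        \<le> dot m (mat_vec d R (sum_list xs)) (mat_vec d R (sum_list xs))"
    if "set xs \<subseteq> T" "real (length xs) * \<delta>\<^sup>2 \<le> 1" for xs
    using low[OF that] mpos by (simp add: Q field_simps)
  have "\<bar>dot m (mat_vec d R v) (mat_vec d R v) - 1\<bar> \<le> \<delta>" if "v \<in> T" for v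
  proof -
    have "\<delta>\<^sup>2 \<le> 1" using \<delta> by (simp add: power_le_one)
    \<comment> \<open>A list of length one loses only \<open>\<delta>\<close>, so the bound for sums
      covers single directions.\<close>
    then have "1 - \<delta> \<le> dot m (mat_vec d R v) (mat_vec d R v)"
      using low'[of "[v]"] that T(2)[OF that] by simp
    then show ?thesis using up'[OF that] by linarith
  qed
  moreover have "enorm d (\<Sum>i\<in>I. c i *\<^sub>R v i)
        \<le> enorm m (mat_vec d R (\<Sum>i\<in>I. c i *\<^sub>R v i)) + 5 * \<delta> * (\<Sum>i\<in>I. \<bar>c i\<bar>)"
    if I: "finite I" "v ` I \<subseteq> T" for I :: "'i set" and c v
  proof (cases "(\<Sum>i\<in>I. \<bar>c i\<bar>) = 0")
    case True
    then have "(\<Sum>i\<in>I. c i *\<^sub>R v i) = 0" using I(1) by (intro sum.neutral) (simp add: sum_nonneg_eq_0_iff)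
    then show ?thesis using True by simp
  next
    case False
    define C where "C = (\<Sum>i\<in>I. \<bar>c i\<bar>)"
    have C: "0 < C" using False unfolding C_def by (simp add: less_le sum_nonneg)
    define w where "w i = (if c i < 0 then - v i else v i)" for i
    define z where "z = (\<Sum>i\<in>I. (\<bar>c i\<bar> / C) *\<^sub>R w i)"
    have eq: "(\<Sum>i\<in>I. c i *\<^sub>R v i) = C *\<^sub>R z"
      unfolding z_def scaleR_right.sum using C by (intro sum.cong) (auto simp: w_def)
    have "enorm d z \<le> enorm m (mat_vec d R z) + 5 * \<delta>"
    proof (rule hull_lower_bound[OF T(2) \<delta>(1) up' low' _ _ _ _ z_def])
      show "(\<Sum>i\<in>I. \<bar>c i\<bar> / C) = 1"
        using C unfolding sum_divide_distrib[symmetric] C_def[symmetric] by simp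
      show "w i \<in> T" if "i \<in> I" for i using I(2) T(4) that by (auto simp: w_def)
    qed (use I C in auto)
    then have "C * enorm d z \<le> C * (enorm m (mat_vec d R z) + 5 * \<delta>)"
      using C by (intro mult_left_mono) auto
    then show ?thesis
      unfolding eq C_def[symmetric] using C by (simp add: mat_vec_scaleR algebra_simps)
  qed
  ultimately show ?thesis by blast
qed

subsection \<open>A Lipschitz selection for the dual problem\<close>

text \<open>The signed residual of projecting onto \<open>[-\<tau>, \<tau>]\<close>: its square is
  the squared distance to that interval, with twice the residual as derivative.\<close>

definition dead_zone :: "real \<Rightarrow> real \<Rightarrow> real" where
  "dead_zone \<tau> t = t - max (- \<tau>) (min \<tau> t)"

text \<open>The projection of \<open>t\<close> lies in the interval and so bounds the distance of
  \<open>t + s\<close>. This quadratic majorant replaces differentiation.\<close>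

lemma dead_zone_shift_square: "0 \<le> \<tau> \<Longrightarrow> (dead_zone \<tau> (t + s))\<^sup>2 \<le> (dead_zone \<tau> t + s)\<^sup>2"
  by (intro abs_le_square_iff[THEN iffD1]) (auto simp: dead_zone_def max_def min_def abs_if)

lemma dead_zone_mono: "0 \<le> \<tau> \<Longrightarrow> 0 \<le> (dead_zone \<tau> t - dead_zone \<tau> s) * (t - s)"
  by (auto simp: dead_zone_def max_def min_def zero_le_mult_iff)

lemma dead_zone_nonexpansive: "0 \<le> \<tau> \<Longrightarrow> \<bar>dead_zone \<tau> t - dead_zone \<tau> s\<bar> \<le> \<bar>t - s\<bar>"
  by (auto simp: dead_zone_def max_def min_def)

lemma dead_zone_mult: "0 \<le> \<tau> \<Longrightarrow> dead_zone \<tau> t * t = \<tau> * \<bar>dead_zone \<tau> t\<bar> + (dead_zone \<tau> t)\<^sup>2"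
  by (auto simp: dead_zone_def max_def min_def abs_if power2_eq_square algebra_simps)

lemma abs_le_dead_zone: "0 \<le> \<tau> \<Longrightarrow> \<bar>t\<bar> \<le> \<tau> + \<bar>dead_zone \<tau> t\<bar>"
  by (auto simp: dead_zone_def max_def min_def abs_if)

text \<open>The first-order optimality condition for minimising
  \<open>\<Sum>i (dead_zone \<tau> (\<langle>z, a i\<rangle> - b i))\<^sup>2 + \<kappa> \<langle>z, z\<rangle>\<close> over the unit ball.\<close>

definition penalty_optimal ::
  "nat \<Rightarrow> 'i set \<Rightarrow> ('i \<Rightarrow> nat \<Rightarrow> real) \<Rightarrow> real \<Rightarrow> real \<Rightarrow> ('i \<Rightarrow> real) \<Rightarrow> (nat \<Rightarrow> real) \<Rightarrow> bool" where
  "penalty_optimal m I a \<tau> \<kappa> b z \<longleftrightarrow> enorm m z \<le> 1 \<and>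
    (\<forall>y. enorm m y \<le> 1 \<longrightarrow>
      0 \<le> (\<Sum>i\<in>I. dead_zone \<tau> (dot m z (a i) - b i) * dot m (y - z) (a i)) + \<kappa> * dot m z (y - z))"

text \<open>A minimiser exists by compactness. Moving it by \<open>t\<close> towards
  \<open>y\<close> and expanding the quadratic majorant gives \<open>0 \<le> 2 * ?G + t * C\<close>;
  small \<open>t\<close> forces \<open>?G \<ge> 0\<close>.\<close>

lemma penalty_optimal_exists:
  assumes \<tau>: "0 \<le> \<tau>"
  shows "\<exists>z. penalty_optimal m I a \<tau> \<kappa> b z"
proof -
  define F where "F z = (\<Sum>i\<in>I. (dead_zone \<tau> (dot m z (a i) - b i))\<^sup>2) + \<kappa> * dot m z z" for z
  \<comment> \<open>The unit ball of \<open>enorm m\<close> is unbounded in the coordinates from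
    \<open>m\<close> on; pinning them to 0 makes the domain compact in the product topology.\<close>
  define Q where "Q = (PiE UNIV (\<lambda>i. if i < m then {-1..1} else {0}) :: (nat \<Rightarrow> real) set)"
  define K where "K = Q \<inter> {z. dot m z z \<le> 1}"
  have contdot: "continuous_on UNIV (\<lambda>z. dot m z w)" "continuous_on UNIV (\<lambda>z. dot m z z)" for w
    unfolding dot_def by (intro continuous_intros continuous_on_product_coordinates)+
  have "compactin (product_topology (\<lambda>i. euclidean) UNIV) Q"
    unfolding Q_def by (subst compactin_PiE) auto
  then have "compact Q" by (simp add: euclidean_product_topology)
  moreover have "closed {z. dot m z z \<le> 1}"
    by (intro closed_Collect_le contdot continuous_on_const)
  ultimately have K: "compact K" unfolding K_def by (rule compact_Int_closed)
  have "0 \<in> K" by (auto simp: K_def Q_def)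
  have "continuous_on K F"
    unfolding F_def dead_zone_def
    by (intro continuous_intros continuous_on_subset[OF contdot(1)] continuous_on_subset[OF contdot(2)]) auto
  then obtain z where z: "z \<in> K" "\<And>w. w \<in> K \<Longrightarrow> F z \<le> F w"
    using continuous_attains_inf[OF K] \<open>0 \<in> K\<close> by blast
  have znorm: "enorm m z \<le> 1" using z(1) by (simp add: K_def enorm_eq_sqrt_dot)
  have "0 \<le> (\<Sum>i\<in>I. dead_zone \<tau> (dot m z (a i) - b i) * dot m (y - z) (a i)) + \<kappa> * dot m z (y - z)"
    (is "0 \<le> ?G") if y: "enorm m y \<le> 1" for y
  proof (rule ccontr)
    assume neg: "\<not> 0 \<le> ?G"
    define C where "C = (\<Sum>i\<in>I. (dot m (y - z) (a i))\<^sup>2) + \<kappa> * dot m (y - z) (y - z)"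
    have step: "0 \<le> 2 * ?G + t * C" if t: "0 < t" "t \<le> 1" for t
    proof -
      obtain e where diff: "y - z = e" by simp
      define w where "w = z + t *\<^sub>R (y - z)"
      define w' where "w' = (\<lambda>j. if j < m then w j else 0)"
      have dotw: "dot m w' x = dot m w x" "dot m w' w' = dot m w w" for x
        by (auto intro!: dot_cong simp: w'_def)
      have "w = (1 - t) *\<^sub>R z + t *\<^sub>R y" by (simp add: w_def algebra_simps)
      then have "enorm m w \<le> (1 - t) * enorm m z + t * enorm m y"
        using enorm_triangle[of m "(1 - t) *\<^sub>R z" "t *\<^sub>R y"] t by simp
      also have "\<dots> \<le> (1 - t) * 1 + t * 1"
        using t znorm y by (intro add_mono mult_left_mono) auto
      finally have w1: "dot m w w \<le> 1" by (simp add: enorm_eq_sqrt_dot)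
      have "\<bar>w j\<bar> \<le> 1" if "j < m" for j
      proof -
        have "(w j)\<^sup>2 \<le> dot m w w"
          unfolding dot_def power2_eq_square by (rule member_le_sum) (use that in auto)
        then show ?thesis using w1 by (simp add: abs_square_le_1[symmetric])
      qed
      then have "w' \<in> Q" by (auto simp: Q_def w'_def abs_le_iff)
      then have "w' \<in> K" using w1 dotw(2) by (simp only: K_def) simp
      then have "F z \<le> F w'" by (rule z(2))
      also have "F w' = (\<Sum>i\<in>I. (dead_zone \<tau> ((dot m z (a i) - b i) + t * dot m (y - z) (a i)))\<^sup>2) + \<kappa> * dot m w w"
        unfolding F_def dotw(2) unfolding dotw(1) by (simp add: w_def dot_linear algebra_simps)
      also have "\<dots> \<le> (\<Sum>i\<in>I. (dead_zone \<tau> (dot m z (a i) - b i) + t * dot m (y - z) (a i))\<^sup>2) + \<kappa> * dot m w w"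
        by (intro add_right_mono sum_mono dead_zone_shift_square \<tau>)
      also have "(\<Sum>i\<in>I. (dead_zone \<tau> (dot m z (a i) - b i) + t * dot m (y - z) (a i))\<^sup>2)
          = (\<Sum>i\<in>I. (dead_zone \<tau> (dot m z (a i) - b i))\<^sup>2)
            + 2 * t * (\<Sum>i\<in>I. dead_zone \<tau> (dot m z (a i) - b i) * dot m (y - z) (a i))
            + t\<^sup>2 * (\<Sum>i\<in>I. (dot m (y - z) (a i))\<^sup>2)"
        by (simp add: power2_sum power_mult_distrib sum.distrib sum_distrib_left mult_ac)
      also have "dot m w w = dot m z z + 2 * t * dot m z (y - z) + t\<^sup>2 * dot m (y - z) (y - z)"
        by (simp add: w_def dot_linear dot_commute[of m y z] power2_eq_square algebra_simps)
      finally have "0 \<le> t * (2 * ?G + t * C)"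
        unfolding F_def C_def diff by (simp add: algebra_simps power2_eq_square)
      then show ?thesis using t by (simp add: zero_le_mult_iff)
    qed
    \<comment> \<open>Small enough that \<open>t * C \<le> - ?G\<close>, whence
      \<open>2 * ?G + t * C \<le> ?G < 0\<close>.\<close>
    define t where "t = min 1 (- ?G / (\<bar>C\<bar> + 1))"
    have t: "0 < t" "t \<le> 1" using neg by (auto simp: t_def)
    have "t * C \<le> t * (\<bar>C\<bar> + 1)" using t by (intro mult_left_mono) auto
    also have "\<dots> \<le> - ?G / (\<bar>C\<bar> + 1) * (\<bar>C\<bar> + 1)"
      by (intro mult_right_mono) (auto simp: t_def)
    also have "\<dots> = - ?G" by simp
    finally have le: "t * C \<le> - ?G" .
    obtain G where G: "?G = G" by simp
    show False using le step[OF t] neg unfolding G by linarith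
  qed
  then show ?thesis using znorm unfolding penalty_optimal_def by blast
qed

text \<open>Quantitative duality: \<open>hull\<close> is the dual condition for solving the
  inequalities up to \<open>\<tau>\<close> in the unit ball. With \<open>c\<close> the residuals and
  \<open>G\<close> the sum of the \<open>c i *\<^sub>R a i\<close>, optimality tested at
  \<open>- G / |G|\<close> gives \<open>dot m z G \<le> - |G| + \<kappa>\<close>. Then
  \<open>hull\<close> with coefficients \<open>- c\<close> cancels \<open>|G|\<close> and the
  \<open>\<tau>\<close> term, so the squared residuals sum to at most
  \<open>\<kappa>\<close>.\<close>

lemma penalty_optimal_feasible:
  assumes opt: "penalty_optimal m I a \<tau> \<kappa> b z"
    and \<tau>: "0 \<le> \<tau>" and \<kappa>: "0 \<le> \<kappa>" and I: "finite I" "i \<in> I"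
    and hull: "\<And>c. (\<Sum>i\<in>I. c i * b i) \<le> enorm m (\<Sum>i\<in>I. c i *\<^sub>R a i) + \<tau> * (\<Sum>i\<in>I. \<bar>c i\<bar>)"
  shows "\<bar>dot m z (a i) - b i\<bar> \<le> \<tau> + sqrt \<kappa>"
proof -
  define c where "c i = dead_zone \<tau> (dot m z (a i) - b i)" for i
  define G where "G = (\<Sum>i\<in>I. c i *\<^sub>R a i)"
  \<comment> \<open>If \<open>G\<close> has norm 0, division by zero makes \<open>y\<close> vanish,
    and \<open>yG\<close> still holds.\<close>
  define y where "y = (- 1 / enorm m G) *\<^sub>R G"
  have dG: "dot m x G = (\<Sum>i\<in>I. c i * dot m x (a i))" for x
    by (simp add: G_def dot_sum_right dot_linear)
  have y1: "enorm m y \<le> 1" by (simp add: y_def)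
  have yG: "dot m y G = - enorm m G"
    by (simp add: y_def dot_linear enorm_square[symmetric] power2_eq_square)
  have "0 \<le> (\<Sum>i\<in>I. c i * dot m (y - z) (a i)) + \<kappa> * dot m z (y - z)"
    using opt y1 unfolding penalty_optimal_def c_def by blast
  then have 1: "0 \<le> dot m y G - dot m z G + \<kappa> * dot m z y - \<kappa> * dot m z z"
    unfolding dG[symmetric] by (simp add: dot_linear algebra_simps)
  have zy: "dot m z y \<le> 1"
  proof -
    have "dot m z y \<le> enorm m z * enorm m y" using dot_Cauchy_Schwarz[of m z y] by linarith
    also have "\<dots> \<le> 1 * 1" using opt y1 by (intro mult_mono) (auto simp: penalty_optimal_def)
    finally show ?thesis by simp
  qed
  have "\<kappa> * dot m z y \<le> \<kappa> * 1" using zy \<kappa> by (rule mult_left_mono)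
  moreover have "0 \<le> \<kappa> * dot m z z" using \<kappa> by simp
  ultimately have 2: "dot m z G \<le> - enorm m G + \<kappa>" using 1 yG by simp
  have "(\<Sum>i\<in>I. - c i * b i) \<le> enorm m (\<Sum>i\<in>I. - c i *\<^sub>R a i) + \<tau> * (\<Sum>i\<in>I. \<bar>- c i\<bar>)"
    by (rule hull)
  moreover have "(\<Sum>i\<in>I. - c i *\<^sub>R a i) = - G" by (simp only: G_def sum_negf scaleR_minus_left)
  ultimately have "- (\<Sum>i\<in>I. c i * b i) \<le> enorm m G + \<tau> * (\<Sum>i\<in>I. \<bar>c i\<bar>)"
    by (simp add: sum_negf)
  moreover have "dot m z G - (\<Sum>i\<in>I. c i * b i) = \<tau> * (\<Sum>i\<in>I. \<bar>c i\<bar>) + (\<Sum>i\<in>I. (c i)\<^sup>2)"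
  proof -
    have "dot m z G - (\<Sum>i\<in>I. c i * b i) = (\<Sum>i\<in>I. c i * (dot m z (a i) - b i))"
      by (simp add: dG right_diff_distrib sum_subtractf)
    also have "\<dots> = (\<Sum>i\<in>I. \<tau> * \<bar>c i\<bar> + (c i)\<^sup>2)"
      unfolding c_def by (intro sum.cong refl dead_zone_mult \<tau>)
    finally show ?thesis by (simp add: sum.distrib sum_distrib_left)
  qed
  ultimately have "(\<Sum>i\<in>I. (c i)\<^sup>2) \<le> \<kappa>" using 2 by linarith
  moreover have "(c i)\<^sup>2 \<le> (\<Sum>i\<in>I. (c i)\<^sup>2)"
    using I by (intro member_le_sum) auto
  ultimately have "\<bar>c i\<bar> \<le> sqrt \<kappa>" by (intro real_le_rsqrt) simp
  then show ?thesis using abs_le_dead_zone[OF \<tau>, of "dot m z (a i) - b i"] by (simp add: c_def)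
qed

text \<open>The regularisation by \<open>\<kappa>\<close> makes the gradient strongly monotone, so the minimiser is a
  Lipschitz function of \<open>b\<close>.\<close>

lemma penalty_optimal_Lipschitz:
  assumes opt: "penalty_optimal m I a \<tau> \<kappa> b z" "penalty_optimal m I a \<tau> \<kappa> b' z'"
    and \<tau>: "0 \<le> \<tau>" and \<kappa>: "0 < \<kappa>"
    and A: "\<And>i. i \<in> I \<Longrightarrow> enorm m (a i) \<le> A" "0 \<le> A"
    and \<beta>: "\<And>i. i \<in> I \<Longrightarrow> \<bar>b i - b' i\<bar> \<le> \<beta>" "0 \<le> \<beta>"
  shows "enorm m (z - z') \<le> (real (card I) * (A + 1) / \<kappa> + 1) * \<beta>"
proof (rule ccontr)
  \<comment> \<open>The summand 1 ensures \<open>L \<ge> 1\<close>, so the contrary assumption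
    \<open>L * \<beta> < r\<close> also gives \<open>\<beta> \<le> r\<close>.\<close>
  define L where "L = real (card I) * (A + 1) / \<kappa> + 1"
  define r where "r = enorm m (z - z')"
  assume "\<not> ?thesis"
  then have less: "L * \<beta> < r" by (simp add: L_def r_def)
  have L1: "1 \<le> L" using A(2) \<kappa> by (simp add: L_def)
  then have \<beta>r: "\<beta> \<le> r" using mult_right_mono[of 1 L \<beta>] \<beta>(2) less by linarith
  have rpos: "0 < r" using less L1 \<beta>(2) by (meson le_less_trans mult_nonneg_nonneg order_trans zero_le_one)
  define c where "c i = dead_zone \<tau> (dot m z (a i) - b i)" for i
  define c' where "c' i = dead_zone \<tau> (dot m z' (a i) - b' i)" for i
  \<comment> \<open>Each solution is the test point for the other; adding the two conditions
    isolates \<open>\<kappa> * |z - z'|^2\<close>.\<close>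
  have "0 \<le> (\<Sum>i\<in>I. c i * dot m (z' - z) (a i)) + \<kappa> * dot m z (z' - z)"
    "0 \<le> (\<Sum>i\<in>I. c' i * dot m (z - z') (a i)) + \<kappa> * dot m z' (z - z')"
    using opt unfolding penalty_optimal_def c_def c'_def by blast+
  then have "\<kappa> * dot m (z - z') (z - z') \<le> (\<Sum>i\<in>I. c i * dot m (z' - z) (a i)) + (\<Sum>i\<in>I. c' i * dot m (z - z') (a i))"
    by (simp add: dot_linear dot_commute[of m z' z] algebra_simps)
  also have "\<dots> = (\<Sum>i\<in>I. (c i - c' i) * dot m (z' - z) (a i))"
    by (simp add: sum.distrib[symmetric] dot_linear algebra_simps)
  also have "\<dots> \<le> (\<Sum>i\<in>I. ((A + 1) * r) * \<beta>)"
  proof (rule sum_mono)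
    fix i assume i: "i \<in> I"
    define s where "s = dot m z (a i) - b i"
    define s' where "s' = dot m z' (a i) - b' i"
    have cs: "c i = dead_zone \<tau> s" "c' i = dead_zone \<tau> s'" by (simp_all add: c_def c'_def s_def s'_def)
    have d: "dot m (z' - z) (a i) = (s' - s) + (b' i - b i)" by (simp add: s_def s'_def dot_linear)
    \<comment> \<open>The first summand on the right is nonpositive by monotonicity, so only the
      change of data contributes.\<close>
    have "(c i - c' i) * dot m (z' - z) (a i) = - ((c i - c' i) * (s - s')) + (c i - c' i) * (b' i - b i)"
      unfolding d by (simp add: algebra_simps)
    also have "\<dots> \<le> \<bar>c i - c' i\<bar> * \<bar>b i - b' i\<bar>"
      using dead_zone_mono[OF \<tau>, of s s'] abs_ge_self[of "(c i - c' i) * (b' i - b i)"]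
      by (simp add: cs abs_mult abs_minus_commute)
    also have "\<dots> \<le> ((A + 1) * r) * \<beta>"
    proof (intro mult_mono \<beta>(1) i)
      have "\<bar>c i - c' i\<bar> \<le> \<bar>s - s'\<bar>" unfolding cs by (rule dead_zone_nonexpansive[OF \<tau>])
      also have "s - s' = dot m (z - z') (a i) - (b i - b' i)" by (simp add: s_def s'_def dot_linear)
      also have "\<bar>\<dots>\<bar> \<le> \<bar>dot m (z - z') (a i)\<bar> + \<bar>b i - b' i\<bar>" by (rule abs_triangle_ineq4)
      also have "\<bar>dot m (z - z') (a i)\<bar> \<le> r * enorm m (a i)" unfolding r_def by (rule dot_Cauchy_Schwarz)
      also have "\<dots> \<le> r * A" using A(1)[OF i] rpos by (intro mult_left_mono) auto
      also have "\<bar>b i - b' i\<bar> \<le> r" using \<beta>(1)[OF i] \<beta>r by linarith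
      finally show "\<bar>c i - c' i\<bar> \<le> (A + 1) * r" by (simp add: algebra_simps)
    qed (use A rpos in auto)
    finally show "(c i - c' i) * dot m (z' - z) (a i) \<le> ((A + 1) * r) * \<beta>" .
  qed
  also have "\<dots> = (real (card I) * (A + 1)) * r * \<beta>" by simp
  finally have "\<kappa> * (r * r) \<le> (real (card I) * (A + 1)) * r * \<beta>"
    by (simp add: r_def enorm_square[symmetric] power2_eq_square)
  also have "real (card I) * (A + 1) = \<kappa> * (L - 1)" using \<kappa> by (simp add: L_def)
  also have "\<kappa> * (L - 1) * r * \<beta> = \<kappa> * r * (L * \<beta>) - \<kappa> * r * \<beta>" by (simp add: algebra_simps)
  also have "\<dots> \<le> \<kappa> * r * (L * \<beta>)" using \<kappa> rpos \<beta>(2) by simp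
  also have "\<dots> < \<kappa> * r * r" using less \<kappa> rpos by (intro mult_strict_left_mono) auto
  finally show False by (simp add: mult.assoc)
qed

text \<open>For a unit vector \<open>w\<close>, Cauchy-Schwarz turns \<open>hull\<close> into the
  dual condition for the data \<open>dot d w (v i)\<close>, which are 1-Lipschitz in
  \<open>w\<close>. The choice \<open>\<kappa> = \<delta>^2\<close> costs
  \<open>sqrt \<kappa> = \<delta>\<close>, turning 5 into 6.\<close>

lemma unit_dual_selection:
  assumes I: "finite I" and v: "\<And>i. i \<in> I \<Longrightarrow> enorm d (v i) = 1"
    and \<delta>: "0 < \<delta>"
    and hull: "\<And>c. enorm d (\<Sum>i\<in>I. c i *\<^sub>R v i)
        \<le> enorm m (\<Sum>i\<in>I. c i *\<^sub>R a i) + 5 * \<delta> * (\<Sum>i\<in>I. \<bar>c i\<bar>)"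
  shows "\<exists>\<zeta> L. 0 \<le> L \<and> (\<forall>w. enorm d w = 1 \<longrightarrow> enorm m (\<zeta> w) \<le> 1 \<and>
      (\<forall>i\<in>I. \<bar>dot m (\<zeta> w) (a i) - dot d w (v i)\<bar> \<le> 6 * \<delta>)) \<and>
      (\<forall>w w'. enorm m (\<zeta> w - \<zeta> w') \<le> L * enorm d (w - w'))"
proof -
  define b where "b w i = dot d w (v i)" for w i
  have "\<exists>z. penalty_optimal m I a (5 * \<delta>) (\<delta>\<^sup>2) (b w) z" for w
    using \<delta> by (intro penalty_optimal_exists) simp
  then obtain \<zeta> where \<zeta>: "\<And>w. penalty_optimal m I a (5 * \<delta>) (\<delta>\<^sup>2) (b w) (\<zeta> w)" by metis
  define A where "A = (\<Sum>i\<in>I. enorm m (a i))"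
  have A: "0 \<le> A" "\<And>i. i \<in> I \<Longrightarrow> enorm m (a i) \<le> A"
    unfolding A_def using I by (auto intro!: sum_nonneg member_le_sum)
  define L where "L = real (card I) * (A + 1) / \<delta>\<^sup>2 + 1"
  have "enorm m (\<zeta> w - \<zeta> w') \<le> L * enorm d (w - w')" for w w'
    unfolding L_def
  proof (rule penalty_optimal_Lipschitz[OF \<zeta> \<zeta>])
    fix i assume "i \<in> I"
    then show "\<bar>b w i - b w' i\<bar> \<le> enorm d (w - w')"
      using dot_Cauchy_Schwarz[of d "w - w'" "v i"] v by (simp add: b_def dot_linear)
  qed (use \<delta> A in auto)
  moreover have "\<bar>dot m (\<zeta> w) (a i) - dot d w (v i)\<bar> \<le> 6 * \<delta>" if w: "enorm d w = 1" and i: "i \<in> I" for w i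
  proof -
    have "\<bar>dot m (\<zeta> w) (a i) - b w i\<bar> \<le> 5 * \<delta> + sqrt (\<delta>\<^sup>2)"
    proof (rule penalty_optimal_feasible[OF \<zeta> _ _ I i])
      fix c
      have "(\<Sum>i\<in>I. c i * b w i) = dot d w (\<Sum>i\<in>I. c i *\<^sub>R v i)"
        by (simp add: b_def dot_sum_right dot_linear)
      also have "\<dots> \<le> enorm d (\<Sum>i\<in>I. c i *\<^sub>R v i)"
        using dot_Cauchy_Schwarz[of d w "\<Sum>i\<in>I. c i *\<^sub>R v i"] w by simp
      finally show "(\<Sum>i\<in>I. c i * b w i) \<le> enorm m (\<Sum>i\<in>I. c i *\<^sub>R a i) + 5 * \<delta> * (\<Sum>i\<in>I. \<bar>c i\<bar>)"
        using hull[of c] by linarith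
    qed (use \<delta> in auto)
    then show ?thesis using \<delta> by (simp add: b_def)
  qed
  moreover have "0 \<le> L" using A by (simp add: L_def)
  ultimately show ?thesis using \<zeta> unfolding penalty_optimal_def by blast
qed

text \<open>Extends the selection from the sphere by degree-one homogeneity. At norm at least
  \<open>r\<close>, normalising is Lipschitz with constant \<open>2 / r\<close>, which the factor
  \<open>enorm d w' \<le> 3 * r\<close> compensates; so one \<open>C\<close> serves every
  annulus.\<close>

lemma homogeneous_dual_selection:
  assumes I: "finite I" and v: "\<And>i. i \<in> I \<Longrightarrow> enorm d (v i) = 1"
    and \<delta>: "0 < \<delta>"
    and hull: "\<And>c. enorm d (\<Sum>i\<in>I. c i *\<^sub>R v i)
        \<le> enorm m (\<Sum>i\<in>I. c i *\<^sub>R a i) + 5 * \<delta> * (\<Sum>i\<in>I. \<bar>c i\<bar>)"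
  shows "\<exists>g C. 0 \<le> C \<and> (\<forall>w. enorm m (g w) \<le> enorm d w) \<and>
      (\<forall>w. \<forall>i\<in>I. \<bar>dot m (g w) (a i) - dot d w (v i)\<bar> \<le> 6 * \<delta> * enorm d w) \<and>
      (\<forall>w w' r. 0 < r \<longrightarrow> r \<le> enorm d w \<longrightarrow> r \<le> enorm d w' \<longrightarrow> enorm d w' \<le> 3 * r \<longrightarrow>
        enorm m (g w - g w') \<le> C * enorm d (w - w'))"
proof -
  obtain \<zeta> L where L: "0 \<le> L"
    and \<zeta>1: "\<And>w. enorm d w = 1 \<Longrightarrow> enorm m (\<zeta> w) \<le> 1"
    and \<zeta>2: "\<And>w i. enorm d w = 1 \<Longrightarrow> i \<in> I \<Longrightarrow> \<bar>dot m (\<zeta> w) (a i) - dot d w (v i)\<bar> \<le> 6 * \<delta>"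
    and \<zeta>3: "\<And>w w'. enorm m (\<zeta> w - \<zeta> w') \<le> L * enorm d (w - w')"
    using unit_dual_selection[OF I v \<delta> hull] by blast
  define u where "u w = (1 / enorm d w) *\<^sub>R w" for w
  define g where "g w = enorm d w *\<^sub>R \<zeta> (u w)" for w
  have u1: "enorm d (u w) = 1" if "enorm d w \<noteq> 0" for w using that by (simp add: u_def)
  have "enorm m (g w) \<le> enorm d w" for w
  proof (cases "enorm d w = 0")
    case False
    then show ?thesis using mult_left_mono[OF \<zeta>1[OF u1[OF False]], of "enorm d w"] by (simp add: g_def)
  qed (simp add: g_def)
  moreover have "\<bar>dot m (g w) (a i) - dot d w (v i)\<bar> \<le> 6 * \<delta> * enorm d w" if i: "i \<in> I" for w i
  proof (cases "enorm d w = 0")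
    case True
    then have "dot d w (v i) = 0" using dot_Cauchy_Schwarz[of d w "v i"] by simp
    then show ?thesis using True by (simp add: g_def)
  next
    case False
    then have "w = enorm d w *\<^sub>R u w" by (simp add: u_def)
    then have "dot d w (v i) = enorm d w * dot d (u w) (v i)" by (metis dot_scaleR_left)
    then have "dot m (g w) (a i) - dot d w (v i) = enorm d w * (dot m (\<zeta> (u w)) (a i) - dot d (u w) (v i))"
      by (simp add: g_def dot_linear algebra_simps)
    then show ?thesis
      using mult_left_mono[OF \<zeta>2[OF u1[OF False] i], of "enorm d w"] by (simp add: abs_mult mult_ac)
  qed
  moreover have "enorm m (g w - g w') \<le> (1 + 6 * L) * enorm d (w - w')"
    if r: "0 < r" "r \<le> enorm d w" "r \<le> enorm d w'" "enorm d w' \<le> 3 * r" for w w' r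
  proof -
    define D where "D = enorm d (w - w')"
    have D: "\<bar>enorm d w - enorm d w'\<bar> \<le> D" unfolding D_def by (rule enorm_reverse_triangle)
    have pos: "0 < enorm d w" "0 < enorm d w'" using r by linarith+
    have "u w - u w' = (1 / enorm d w) *\<^sub>R (w - w') + (1 / enorm d w - 1 / enorm d w') *\<^sub>R w'"
      by (simp add: u_def algebra_simps)
    then have "enorm d (u w - u w') \<le> D / enorm d w + \<bar>1 / enorm d w - 1 / enorm d w'\<bar> * enorm d w'"
      using enorm_triangle[of d "(1 / enorm d w) *\<^sub>R (w - w')" "(1 / enorm d w - 1 / enorm d w') *\<^sub>R w'"] pos
      by (simp add: D_def)
    moreover have "\<bar>1 / enorm d w - 1 / enorm d w'\<bar> * enorm d w' = \<bar>enorm d w - enorm d w'\<bar> / enorm d w"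
    proof -
      have "1 / enorm d w - 1 / enorm d w' = (enorm d w' - enorm d w) / (enorm d w * enorm d w')"
        using pos by (simp add: field_simps)
      then show ?thesis using pos by (simp add: abs_divide abs_mult abs_minus_commute)
    qed
    moreover have "\<bar>enorm d w - enorm d w'\<bar> / enorm d w \<le> D / enorm d w"
      using D pos by (intro divide_right_mono) auto
    ultimately have "enorm d (u w - u w') \<le> 2 * D / enorm d w" by linarith
    also have "\<dots> \<le> 2 * D / r" using r by (intro divide_left_mono) (auto simp: D_def)
    finally have u: "enorm d (u w - u w') \<le> 2 * D / r" .
    have "enorm m (\<zeta> (u w) - \<zeta> (u w')) \<le> L * enorm d (u w - u w')" by (rule \<zeta>3)
    also have "\<dots> \<le> L * (2 * D / r)" using u L by (rule mult_left_mono)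
    finally have \<zeta>D: "enorm m (\<zeta> (u w) - \<zeta> (u w')) \<le> L * (2 * D / r)" .
    have "g w - g w' = (enorm d w - enorm d w') *\<^sub>R \<zeta> (u w) + enorm d w' *\<^sub>R (\<zeta> (u w) - \<zeta> (u w'))"
      by (simp add: g_def algebra_simps)
    then have "enorm m (g w - g w') \<le> \<bar>enorm d w - enorm d w'\<bar> * enorm m (\<zeta> (u w)) + enorm d w' * enorm m (\<zeta> (u w) - \<zeta> (u w'))"
      using enorm_triangle[of m "(enorm d w - enorm d w') *\<^sub>R \<zeta> (u w)" "enorm d w' *\<^sub>R (\<zeta> (u w) - \<zeta> (u w'))"]
      by simp
    also have "\<dots> \<le> D * 1 + (3 * r) * (L * (2 * D / r))"
      using D \<zeta>1[OF u1[of w]] pos r \<zeta>D by (intro add_mono mult_mono) auto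
    also have "\<dots> = (1 + 6 * L) * D" using r by (simp add: field_simps)
    finally show ?thesis by (simp add: D_def)
  qed
  moreover have "0 \<le> 1 + 6 * L" using L by simp
  ultimately show ?thesis by blast
qed

subsection \<open>Points with a unique nearest neighbour\<close>

text \<open>Fubini in coordinate \<open>i\<close>: with the other coordinates fixed, the hyperplane
  leaves a single value for this one.\<close>

lemma AE_not_on_hyperplane:
  assumes i: "i < d" "a i \<noteq> 0"
  shows "AE u in lebesgue_d d. dot d u a \<noteq> \<beta>"
proof -
  interpret product_sigma_finite "\<lambda>_::nat. lborel :: real measure" ..
  define J where "J = {..<d} - {i}"
  have J: "finite J" "i \<notin> J" "{..<d} = insert i J" using i by (auto simp: J_def)
  define M where "M = PiM {..<d} (\<lambda>_. lborel :: real measure)"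
  define N where "N = {u \<in> space M. dot d u a = \<beta>}"
  have [measurable]: "(\<lambda>u. dot d u a) \<in> borel_measurable M"
    unfolding dot_def M_def by measurable
  have N[measurable]: "N \<in> sets M" unfolding N_def by measurable
  have "emeasure M N = (\<integral>\<^sup>+ u. indicator N u \<partial>M)" by simp
  also have "\<dots> = (\<integral>\<^sup>+ x. (\<integral>\<^sup>+ y. indicator N (x(i := y)) \<partial>lborel) \<partial>PiM J (\<lambda>_. lborel))"
    using N unfolding M_def J(3) by (intro product_nn_integral_insert J) auto
  also have "\<dots> = (\<integral>\<^sup>+ x. 0 \<partial>PiM J (\<lambda>_. lborel :: real measure))"
  proof (intro nn_integral_cong)
    fix x :: "nat \<Rightarrow> real"
    define c where "c = (\<Sum>j\<in>J. x j * a j)"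
    have dot: "dot d (x(i := y)) a = y * a i + c" for y
    proof -
      have "(\<Sum>j\<in>J. (x(i := y)) j * a j) = c"
        unfolding c_def using J(2) by (intro sum.cong) auto
      then show ?thesis unfolding dot_def J(3) sum.insert[OF J(1,2)] by simp
    qed
    have "AE y in lborel. indicator N (x(i := y)) = (0 :: ennreal)"
      using AE_lborel_singleton[of "(\<beta> - c) / a i"]
    proof eventually_elim
      case (elim y)
      then have "x(i := y) \<notin> N" using i by (auto simp: N_def dot field_simps)
      then show ?case by simp
    qed
    then have "(\<integral>\<^sup>+ y. indicator N (x(i := y)) \<partial>lborel) = (\<integral>\<^sup>+ y. 0 \<partial>(lborel :: real measure))"
      by (rule nn_integral_cong_AE)
    also have "\<dots> = 0" by simp
    finally show "(\<integral>\<^sup>+ y. indicator N (x(i := y)) \<partial>lborel) = 0" .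
  qed
  finally have "emeasure M N = 0" by simp
  then have "AE u in M. u \<notin> N" using N by (intro AE_not_in) (simp add: null_sets_def)
  then have "AE u in M. dot d u a \<noteq> \<beta>"
    by (rule AE_mp) (auto simp: N_def intro!: AE_I2)
  then show ?thesis unfolding lebesgue_d_def M_def .
qed

lemma euclid_eqI:
  assumes "x \<in> euclid d" "y \<in> euclid d" "enorm d (x - y) = 0"
  shows "x = y"
  using assms unfolding euclid_def by (intro PiE_ext[of x _ _ y]) (auto simp: enorm_eq_0_iff)

lemma enorm_sub_square: "(enorm d (x - y))\<^sup>2 = dot d x x - 2 * dot d x y + dot d y y"
  by (simp add: enorm_square dot_linear dot_commute[of d y x])

text \<open>Points equidistant from \<open>x\<close> and \<open>y\<close> lie on a hyperplane with
  normal \<open>x - y\<close>, and only finitely many such null sets arise. For \<open>d = 0\<close>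
  the only point of the space belongs to \<open>X\<close>.\<close>

lemma AE_unique_nearest:
  assumes X: "finite X" "X \<noteq> {}" "X \<subseteq> euclid d" and d: "0 < d"
  shows "AE u in lebesgue_d d. u \<in> euclid d - X \<and> unique_nearest d X u"
proof -
  have sp: "AE u in lebesgue_d d. u \<in> euclid d"
    by (rule AE_I2) (simp add: lebesgue_d_def space_PiM euclid_def)
  have "AE u in lebesgue_d d. \<forall>x\<in>X. u \<noteq> x"
  proof (rule AE_finite_allI[OF X(1)])
    fix x
    \<comment> \<open>The first unit vector: \<open>x\<close> lies on the hyperplane of points
      \<open>u\<close> with \<open>u 0 = x 0\<close>.\<close>
    let ?a = "\<lambda>j::nat. if j = 0 then 1 else 0 :: real"
    have "dot d u ?a = u 0" for u using d by (simp add: dot_def if_distrib cong: if_cong)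
    then show "AE u in lebesgue_d d. u \<noteq> x"
      using AE_not_on_hyperplane[of 0 d ?a "x 0"] d by (auto elim!: AE_mp)
  qed
  moreover have "AE u in lebesgue_d d. \<forall>x\<in>X. \<forall>y\<in>X. x \<noteq> y \<longrightarrow> edist d u x \<noteq> edist d u y"
  proof (intro AE_finite_allI[OF X(1)])
    fix x y assume xy: "x \<in> X" "y \<in> X"
    show "AE u in lebesgue_d d. x \<noteq> y \<longrightarrow> edist d u x \<noteq> edist d u y"
    proof (cases "x = y")
      case False
      then have "enorm d (x - y) \<noteq> 0" using euclid_eqI X(3) xy by blast
      then obtain i where i: "i < d" "(x - y) i \<noteq> 0" by (auto simp: enorm_eq_0_iff)
      show ?thesis
        using AE_not_on_hyperplane[where a = "x - y", OF i, of "(dot d x x - dot d y y) / 2"]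
      proof eventually_elim
        case (elim u)
        have "(edist d u x)\<^sup>2 \<noteq> (edist d u y)\<^sup>2"
          using elim by (simp add: edist_eq enorm_sub_square dot_linear)
        then show ?case by auto
      qed
    qed simp
  qed
  ultimately show ?thesis using sp
  proof eventually_elim
    case (elim u)
    obtain x where x: "x \<in> X" "\<And>y. y \<in> X \<Longrightarrow> edist d u x \<le> edist d u y"
      using ex_is_arg_min_if_finite[OF X(1,2), of "edist d u"]
      by (auto simp: is_arg_min_linorder)
    have "unique_nearest d X u"
      unfolding unique_nearest_def
    proof (intro ex1I[of _ x] conjI ballI x)
      fix z assume z: "z \<in> X \<and> (\<forall>y\<in>X. edist d u z \<le> edist d u y)"
      then have "edist d u z = edist d u x" using x by (intro antisym) auto
      then show "z = x" using elim(2) x(1) z by blast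
    qed
    then show ?case using elim by blast
  qed
qed

subsection \<open>The terminal embedding\<close>

text \<open>The normalised differences form a symmetric set of at most \<open>card X ^ 2\<close>
  unit vectors; scaling transfers the estimate to the differences. Rounding \<open>m\<close> up
  costs 1, covered by \<open>2 * ln (card X) / \<delta>^2\<close>, hence 66 instead of 64.\<close>

lemma distortion_matrix_exists:
  assumes X: "finite X" "X \<noteq> {}" "X \<subseteq> euclid d" and \<delta>: "0 < \<delta>" "\<delta> < 1"
  shows "\<exists>m R. real m \<le> 66 * ln (real (card X)) / \<delta>\<^sup>2
    \<and> (\<forall>x\<in>X. \<forall>y\<in>X. \<bar>dot m (mat_vec d R (x - y)) (mat_vec d R (x - y)) - dot d (x - y) (x - y)\<bar>
          \<le> \<delta> * dot d (x - y) (x - y))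
    \<and> (\<forall>x0\<in>X. \<forall>c :: (nat \<Rightarrow> real) \<Rightarrow> real.
        enorm d (\<Sum>x\<in>X - {x0}. c x *\<^sub>R ((1 / enorm d (x - x0)) *\<^sub>R (x - x0)))
        \<le> enorm m (mat_vec d R (\<Sum>x\<in>X - {x0}. c x *\<^sub>R ((1 / enorm d (x - x0)) *\<^sub>R (x - x0))))
          + 5 * \<delta> * (\<Sum>x\<in>X - {x0}. \<bar>c x\<bar>))"
proof (cases "card X = 1")
  case True
  then obtain x where x: "X = {x}" by (rule card_1_singletonE)
  \<comment> \<open>For a single point \<open>ln 1 = 0\<close> forces \<open>m = 0\<close>, and all
    differences and sums vanish.\<close>
  show ?thesis by (rule exI[of _ 0]) (simp add: x dot_def enorm_def)
next
  case False
  then have n: "2 \<le> card X" using X card_gt_0_iff[of X] by linarith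
  define dir where "dir = (\<lambda>(x, y). (1 / enorm d (x - y)) *\<^sub>R (x - y))"
  define P where "P = {(x, y) \<in> X \<times> X. x \<noteq> y}"
  define T where "T = dir ` P"
  have ne: "enorm d (x - y) \<noteq> 0" if "(x, y) \<in> P" for x y
    using that euclid_eqI[of x d y] X(3) by (auto simp: P_def)
  have finP: "finite P" by (rule finite_subset[of _ "X \<times> X"]) (use X(1) in \<open>auto simp: P_def\<close>)
  have "card T \<le> card P" unfolding T_def by (rule card_image_le[OF finP])
  also have "\<dots> \<le> card (X \<times> X)" using X(1) by (intro card_mono) (auto simp: P_def)
  finally have cardT: "card T \<le> (card X)\<^sup>2" by (simp add: card_cartesian_product power2_eq_square)
  have unit: "dot d v v = 1" if "v \<in> T" for v
  proof -
    obtain e where "e \<in> P" "v = dir e" using \<open>v \<in> T\<close> unfolding T_def by blast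
    then obtain x y where xy: "(x, y) \<in> P" "v = dir (x, y)" by (cases e) auto
    have "enorm d v = 1" unfolding xy(2) dir_def prod.case enorm_scaleR using ne[OF xy(1)] by simp
    then show ?thesis using enorm_square[of d v] by simp
  qed
  have sym: "- v \<in> T" if "v \<in> T" for v
  proof -
    obtain e where "e \<in> P" "v = dir e" using \<open>v \<in> T\<close> unfolding T_def by blast
    then obtain x y where xy: "(x, y) \<in> P" "v = dir (x, y)" by (cases e) auto
    then have "- v = dir (y, x)"
      unfolding dir_def prod.case enorm_minus_commute[of d x y] by (simp add: algebra_simps)
    moreover have "(y, x) \<in> P" using xy(1) by (auto simp: P_def)
    ultimately show ?thesis by (auto simp: T_def)
  qed
  define m where "m = nat \<lceil>64 * ln (real (card X)) / \<delta>\<^sup>2\<rceil>"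
  have lnn: "2 / 3 \<le> ln (real (card X))"
    using ln2_ge_two_thirds n ln_mono[of 2 "real (card X)"] by linarith
  have m1: "64 * ln (real (card X)) / \<delta>\<^sup>2 \<le> real m" unfolding m_def by (rule real_nat_ceiling_ge)
  then have m1': "64 * ln (real (card X)) \<le> real m * \<delta>\<^sup>2" using \<delta> by (simp add: pos_divide_le_eq)
  have "0 \<le> 64 * ln (real (card X)) / \<delta>\<^sup>2" using lnn by simp
  then have "real m \<le> 64 * ln (real (card X)) / \<delta>\<^sup>2 + 1" unfolding m_def by linarith
  moreover have "1 \<le> 2 * ln (real (card X)) / \<delta>\<^sup>2"
  proof -
    have "\<delta>\<^sup>2 \<le> 1" using \<delta> by (simp add: power_le_one)
    then show ?thesis using \<delta> lnn by (simp add: pos_le_divide_eq)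
  qed
  moreover have "64 * ln (real (card X)) / \<delta>\<^sup>2 + 2 * ln (real (card X)) / \<delta>\<^sup>2 = 66 * ln (real (card X)) / \<delta>\<^sup>2"
    by (simp add: add_divide_distrib[symmetric])
  ultimately have m2: "real m \<le> 66 * ln (real (card X)) / \<delta>\<^sup>2" by linarith
  have finT: "finite T" using finP by (simp add: T_def)
  obtain R where R1: "\<And>v. v \<in> T \<Longrightarrow> \<bar>dot m (mat_vec d R v) (mat_vec d R v) - 1\<bar> \<le> \<delta>"
    and R2: "\<And>(I :: (nat \<Rightarrow> real) set) c v. finite I \<Longrightarrow> v ` I \<subseteq> T \<Longrightarrow>
        enorm d (\<Sum>i\<in>I. c i *\<^sub>R v i)
        \<le> enorm m (mat_vec d R (\<Sum>i\<in>I. c i *\<^sub>R v i)) + 5 * \<delta> * (\<Sum>i\<in>I. \<bar>c i\<bar>)"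
    using convex_hull_distortion_exists[where 'i = "nat \<Rightarrow> real", OF finT unit cardT sym n \<delta> m1'] by blast
  have "\<bar>dot m (mat_vec d R (x - y)) (mat_vec d R (x - y)) - dot d (x - y) (x - y)\<bar> \<le> \<delta> * dot d (x - y) (x - y)"
    if "x \<in> X" "y \<in> X" for x y
  proof (cases "x = y")
    case True
    then show ?thesis by (simp add: mat_vec_diff)
  next
    case False
    define l where "l = enorm d (x - y)"
    define v where "v = dir (x, y)"
    have P: "(x, y) \<in> P" using that False by (auto simp: P_def)
    then have v: "v \<in> T" by (auto simp: T_def v_def)
    have xy: "x - y = l *\<^sub>R v" using ne[OF P] by (simp add: v_def dir_def l_def)
    have 1: "dot m (mat_vec d R (x - y)) (mat_vec d R (x - y)) = l\<^sup>2 * dot m (mat_vec d R v) (mat_vec d R v)"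
      unfolding xy mat_vec_scaleR dot_scaleR_left dot_scaleR_right by (simp add: power2_eq_square)
    have 2: "dot d (x - y) (x - y) = l\<^sup>2"
      unfolding xy dot_scaleR_left dot_scaleR_right unit[OF v] by (simp add: power2_eq_square)
    have "\<bar>l\<^sup>2 * dot m (mat_vec d R v) (mat_vec d R v) - l\<^sup>2\<bar> = l\<^sup>2 * \<bar>dot m (mat_vec d R v) (mat_vec d R v) - 1\<bar>"
      using abs_mult[of "l\<^sup>2" "dot m (mat_vec d R v) (mat_vec d R v) - 1"] by (simp add: right_diff_distrib)
    also have "\<dots> \<le> l\<^sup>2 * \<delta>" by (intro mult_left_mono R1 v) simp
    finally show ?thesis unfolding 1 2 by (simp only: mult.commute)
  qed
  moreover have "enorm d (\<Sum>x\<in>X - {x0}. c x *\<^sub>R ((1 / enorm d (x - x0)) *\<^sub>R (x - x0)))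
        \<le> enorm m (mat_vec d R (\<Sum>x\<in>X - {x0}. c x *\<^sub>R ((1 / enorm d (x - x0)) *\<^sub>R (x - x0))))
          + 5 * \<delta> * (\<Sum>x\<in>X - {x0}. \<bar>c x\<bar>)" if "x0 \<in> X" for x0 c
  proof (rule R2)
    show "(\<lambda>x. (1 / enorm d (x - x0)) *\<^sub>R (x - x0)) ` (X - {x0}) \<subseteq> T"
    proof (rule image_subsetI)
      fix x assume "x \<in> X - {x0}"
      then have "(x, x0) \<in> P" using that by (auto simp: P_def)
      then have "dir (x, x0) \<in> T" by (auto simp: T_def)
      then show "(1 / enorm d (x - x0)) *\<^sub>R (x - x0) \<in> T" by (simp add: dir_def)
    qed
  qed (use X(1) in auto)
  ultimately show ?thesis using m2 by blast
qed

text \<open>What the embedding uses: room under its square root, control of the cross term in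
  squared distances, and a Lipschitz bound away from the base point.\<close>

definition terminal_selection ::
  "nat \<Rightarrow> nat \<Rightarrow> (nat \<Rightarrow> nat \<Rightarrow> real) \<Rightarrow> (nat \<Rightarrow> real) set \<Rightarrow> real \<Rightarrow> (nat \<Rightarrow> real)
    \<Rightarrow> ((nat \<Rightarrow> real) \<Rightarrow> nat \<Rightarrow> real) \<Rightarrow> real \<Rightarrow> bool" where
  "terminal_selection d m R X \<delta> x0 g C \<longleftrightarrow> 0 \<le> C \<and> (\<forall>w. enorm m (g w) \<le> enorm d w) \<and>
      (\<forall>w. \<forall>x\<in>X. \<bar>dot m (g w) (mat_vec d R (x - x0)) - dot d w (x - x0)\<bar>
        \<le> 6 * \<delta> * enorm d w * enorm d (x - x0)) \<and>
      (\<forall>w w' r. 0 < r \<longrightarrow> r \<le> enorm d w \<longrightarrow> r \<le> enorm d w' \<longrightarrow> enorm d w' \<le> 3 * r \<longrightarrow>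
        enorm m (g w - g w') \<le> C * enorm d (w - w'))"

lemma terminal_selectionD:
  assumes "terminal_selection d m R X \<delta> x0 g C"
  shows "0 \<le> C" "enorm m (g w) \<le> enorm d w"
    "x \<in> X \<Longrightarrow> \<bar>dot m (g w) (mat_vec d R (x - x0)) - dot d w (x - x0)\<bar>
      \<le> 6 * \<delta> * enorm d w * enorm d (x - x0)"
    "0 < r \<Longrightarrow> r \<le> enorm d w \<Longrightarrow> r \<le> enorm d w' \<Longrightarrow> enorm d w' \<le> 3 * r \<Longrightarrow>
      enorm m (g w - g w') \<le> C * enorm d (w - w')"
  using assms unfolding terminal_selection_def by blast+

lemma terminal_selection_exists:
  assumes X: "finite X" "X \<subseteq> euclid d" and \<delta>: "0 < \<delta>" and x0: "x0 \<in> X"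
    and hull: "\<And>c :: (nat \<Rightarrow> real) \<Rightarrow> real.
        enorm d (\<Sum>x\<in>X - {x0}. c x *\<^sub>R ((1 / enorm d (x - x0)) *\<^sub>R (x - x0)))
        \<le> enorm m (mat_vec d R (\<Sum>x\<in>X - {x0}. c x *\<^sub>R ((1 / enorm d (x - x0)) *\<^sub>R (x - x0))))
          + 5 * \<delta> * (\<Sum>x\<in>X - {x0}. \<bar>c x\<bar>)"
  shows "\<exists>g C. terminal_selection d m R X \<delta> x0 g C"
proof -
  define v where "v x = (1 / enorm d (x - x0)) *\<^sub>R (x - x0)" for x
  have ne: "enorm d (x - x0) \<noteq> 0" if "x \<in> X - {x0}" for x
    using that euclid_eqI[of x d x0] X(2) x0 by auto
  have v1: "enorm d (v x) = 1" if "x \<in> X - {x0}" for x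
    using ne[OF that] by (simp add: v_def)
  have hull': "enorm d (\<Sum>x\<in>X - {x0}. c x *\<^sub>R v x)
        \<le> enorm m (\<Sum>x\<in>X - {x0}. c x *\<^sub>R mat_vec d R (v x)) + 5 * \<delta> * (\<Sum>x\<in>X - {x0}. \<bar>c x\<bar>)" for c
    using hull[of c] unfolding v_def[symmetric] mat_vec_sum mat_vec_scaleR .
  obtain g C where gC: "0 \<le> C" "\<And>w. enorm m (g w) \<le> enorm d w"
    "\<And>w x. x \<in> X - {x0} \<Longrightarrow> \<bar>dot m (g w) (mat_vec d R (v x)) - dot d w (v x)\<bar> \<le> 6 * \<delta> * enorm d w"
    "\<And>w w' r. 0 < r \<Longrightarrow> r \<le> enorm d w \<Longrightarrow> r \<le> enorm d w' \<Longrightarrow> enorm d w' \<le> 3 * r \<Longrightarrow>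
        enorm m (g w - g w') \<le> C * enorm d (w - w')"
    using homogeneous_dual_selection[where I = "X - {x0}" and a = "\<lambda>x. mat_vec d R (v x)", OF _ v1 \<delta> hull'] X(1)
    by blast
  have "\<bar>dot m (g w) (mat_vec d R (x - x0)) - dot d w (x - x0)\<bar> \<le> 6 * \<delta> * enorm d w * enorm d (x - x0)"
    if "x \<in> X" for w x
  proof (cases "x = x0")
    case True
    then show ?thesis by (simp add: mat_vec_diff)
  next
    case False
    then have x: "x \<in> X - {x0}" using that by simp
    define l where "l = enorm d (x - x0)"
    have eq: "x - x0 = l *\<^sub>R v x" using ne[OF x] by (simp add: v_def l_def)
    have l0: "0 \<le> l" by (simp add: l_def)
    have "dot m (g w) (mat_vec d R (x - x0)) - dot d w (x - x0)
        = l * (dot m (g w) (mat_vec d R (v x)) - dot d w (v x))"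
      unfolding eq mat_vec_scaleR dot_scaleR_right right_diff_distrib ..
    then have "\<bar>dot m (g w) (mat_vec d R (x - x0)) - dot d w (x - x0)\<bar>
        = l * \<bar>dot m (g w) (mat_vec d R (v x)) - dot d w (v x)\<bar>"
      using l0 by (simp add: abs_mult)
    also have "\<dots> \<le> l * (6 * \<delta> * enorm d w)" by (rule mult_left_mono[OF gC(3)[OF x] l0])
    finally show ?thesis unfolding l_def by (simp add: mult_ac)
  qed
  then have "terminal_selection d m R X \<delta> x0 g C"
    using gC(1,2,4) unfolding terminal_selection_def by blast
  then show ?thesis by blast
qed

text \<open>If \<open>g\<close> does not increase norms, the last coordinate makes the distance from
  the image of \<open>u\<close> to that of its base point \<open>x\<close> exactly
  \<open>enorm d (u - x)\<close>. \<open>restrict\<close> keeps the values in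
  \<open>euclid (m + 1)\<close>.\<close>

definition terminal_map ::
  "nat \<Rightarrow> nat \<Rightarrow> (nat \<Rightarrow> nat \<Rightarrow> real) \<Rightarrow> ((nat \<Rightarrow> real) \<Rightarrow> nat \<Rightarrow> real) \<Rightarrow> (nat \<Rightarrow> real) \<Rightarrow> (nat \<Rightarrow> real) \<Rightarrow> nat \<Rightarrow> real" where
  "terminal_map d m R g x u = restrict
     (\<lambda>i. if i < m then mat_vec d R x i + g (u - x) i
          else sqrt ((enorm d (u - x))\<^sup>2 - (enorm m (g (u - x)))\<^sup>2)) {..<m + 1}"

lemma edist_terminal_map_square:
  "(edist (m + 1) (terminal_map d m R g x u) (terminal_map d m R h y v))\<^sup>2
   = (enorm m (mat_vec d R (x - y) + (g (u - x) - h (v - y))))\<^sup>2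
     + (sqrt ((enorm d (u - x))\<^sup>2 - (enorm m (g (u - x)))\<^sup>2)
        - sqrt ((enorm d (v - y))\<^sup>2 - (enorm m (h (v - y)))\<^sup>2))\<^sup>2"
proof -
  let ?D = "terminal_map d m R g x u - terminal_map d m R h y v"
  have "dot m ?D ?D = dot m (mat_vec d R (x - y) + (g (u - x) - h (v - y))) (mat_vec d R (x - y) + (g (u - x) - h (v - y)))"
    by (intro dot_cong) (simp_all add: terminal_map_def mat_vec_diff)
  moreover have "?D m = sqrt ((enorm d (u - x))\<^sup>2 - (enorm m (g (u - x)))\<^sup>2)
        - sqrt ((enorm d (v - y))\<^sup>2 - (enorm m (h (v - y)))\<^sup>2)"
    by (simp add: terminal_map_def)
  moreover have "dot (m + 1) ?D ?D = dot m ?D ?D + (?D m)\<^sup>2"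
    by (simp add: dot_Suc power2_eq_square)
  ultimately show ?thesis
    by (simp only: edist_eq enorm_square)
qed

text \<open>With \<open>e = x - x0\<close> and \<open>w = u - x0\<close>, the last coordinate
  cancels \<open>|g w|^2\<close>, so the squared distance is
  \<open>|R e|^2 - 2 * dot m (g w) (R e) + |w|^2\<close>, compared termwise with
  \<open>|e - w|^2\<close>. Since \<open>|w| \<le> D\<close> and \<open>|e| \<le> 2 * D\<close>, the
  errors are \<open>4\<close> and \<open>2 * 12\<close> times \<open>\<delta> * D^2\<close>, hence
  28.\<close>

lemma terminal_map_distortion:
  assumes \<delta>: "0 \<le> \<delta>" and g: "enorm m (g (u - x0)) \<le> enorm d (u - x0)" and h: "\<And>w. enorm m (h w) \<le> enorm d w"
    and near: "enorm d (u - x0) \<le> enorm d (x - u)"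
    and lin: "\<bar>dot m (mat_vec d R (x - x0)) (mat_vec d R (x - x0)) - dot d (x - x0) (x - x0)\<bar>
          \<le> \<delta> * dot d (x - x0) (x - x0)"
    and cross: "\<bar>dot m (g (u - x0)) (mat_vec d R (x - x0)) - dot d (u - x0) (x - x0)\<bar>
        \<le> 6 * \<delta> * enorm d (u - x0) * enorm d (x - x0)"
  shows "\<bar>(edist (m + 1) (terminal_map d m R h x x) (terminal_map d m R g x0 u))\<^sup>2 - (edist d x u)\<^sup>2\<bar>
    \<le> 28 * \<delta> * (edist d x u)\<^sup>2"
proof -
  define e where "e = x - x0"
  define w where "w = u - x0"
  define D where "D = edist d x u"
  define G where "G = g w"
  have Dew: "D = enorm d (e - w)" by (simp add: D_def edist_eq e_def w_def)
  have D0: "0 \<le> D" by (simp add: D_def edist_eq)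
  have wD: "enorm d w \<le> D" using near by (simp add: w_def D_def edist_eq)
  have eD: "enorm d e \<le> 2 * D"
    using enorm_triangle[of d "e - w" w] wD by (simp add: Dew)
  have h0: "enorm m (h 0) = 0" using h[of 0] enorm_nonneg[of m "h 0"] by simp
  then have h0': "dot m (h 0) z = 0" "dot m z (h 0) = 0" for z
    using dot_Cauchy_Schwarz[of m "h 0" z] by (simp_all add: dot_commute[of m z])
  have "(edist (m + 1) (terminal_map d m R h x x) (terminal_map d m R g x0 u))\<^sup>2
      = (enorm m (mat_vec d R e + (h 0 - G)))\<^sup>2 + (sqrt ((enorm d w)\<^sup>2 - (enorm m G)\<^sup>2))\<^sup>2"
    unfolding edist_terminal_map_square by (simp add: h0 e_def w_def G_def)
  also have "(sqrt ((enorm d w)\<^sup>2 - (enorm m G)\<^sup>2))\<^sup>2 = (enorm d w)\<^sup>2 - (enorm m G)\<^sup>2"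
    using power_mono[OF g, of 2] by (simp add: G_def w_def)
  also have "(enorm m (mat_vec d R e + (h 0 - G)))\<^sup>2
      = dot m (mat_vec d R e) (mat_vec d R e) - 2 * dot m G (mat_vec d R e) + (enorm m G)\<^sup>2"
    unfolding enorm_square by (simp add: dot_linear h0' dot_commute[of m "mat_vec d R e" G])
  finally have 1: "(edist (m + 1) (terminal_map d m R h x x) (terminal_map d m R g x0 u))\<^sup>2
      = dot m (mat_vec d R e) (mat_vec d R e) - 2 * dot m G (mat_vec d R e) + (enorm d w)\<^sup>2"
    by simp
  have 2: "D\<^sup>2 = dot d e e - 2 * dot d w e + (enorm d w)\<^sup>2"
    unfolding Dew enorm_sub_square by (simp add: dot_commute[of d e w] enorm_square)
  have "dot d e e \<le> 4 * D\<^sup>2"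
    using power_mono[OF eD, of 2] by (simp add: enorm_square power_mult_distrib)
  then have "\<delta> * dot d e e \<le> \<delta> * (4 * D\<^sup>2)" using \<delta> by (rule mult_left_mono)
  then have 3: "\<bar>dot m (mat_vec d R e) (mat_vec d R e) - dot d e e\<bar> \<le> 4 * (\<delta> * D\<^sup>2)"
    using lin unfolding e_def[symmetric] by linarith
  have "enorm d w * enorm d e \<le> D * (2 * D)"
    using wD eD D0 by (intro mult_mono) auto
  then have "6 * \<delta> * (enorm d w * enorm d e) \<le> 6 * \<delta> * (D * (2 * D))"
    using \<delta> by (intro mult_left_mono) auto
  also have "\<dots> = 12 * (\<delta> * D\<^sup>2)" by (simp add: power2_eq_square)
  finally have 4: "\<bar>dot m G (mat_vec d R e) - dot d w e\<bar> \<le> 12 * (\<delta> * D\<^sup>2)"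
    using cross unfolding e_def[symmetric] w_def[symmetric] G_def[symmetric] by (simp only: mult.assoc)
  have "28 * \<delta> * D\<^sup>2 = 28 * (\<delta> * D\<^sup>2)" by simp
  then show ?thesis unfolding D_def[symmetric] 1 using 2 3 4 by linarith
qed

text \<open>The exponent is lost in \<open>(s - t)^2 \<le> |s^2 - t^2|\<close> for the square roots
  \<open>s\<close> and \<open>t\<close>; the squares are Lipschitz because all norms are at most
  \<open>3 * r\<close>. For the other coordinates \<open>\<gamma>^2 \<le> \<gamma> * (p + q)\<close>
  gives the same form.\<close>

lemma terminal_map_Hoelder:
  assumes C: "0 \<le> C" and r: "0 < r"
    and g: "\<And>w. enorm m (g w) \<le> enorm d w"
    and Lip: "enorm m (g (u - x) - g (v - x)) \<le> C * enorm d ((u - x) - (v - x))"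
    and u: "enorm d (u - x) \<le> 3 * r" and v: "enorm d (v - x) \<le> 3 * r"
  shows "edist (m + 1) (terminal_map d m R g x u) (terminal_map d m R g x v)
    \<le> sqrt (6 * r * (1 + 2 * C)) * edist d u v powr (1/2)"
proof -
  define \<eta> where "\<eta> = edist d u v"
  define a where "a = enorm d (u - x)"
  define b where "b = enorm d (v - x)"
  define p where "p = enorm m (g (u - x))"
  define q where "q = enorm m (g (v - x))"
  define s where "s = sqrt (a\<^sup>2 - p\<^sup>2)"
  define t where "t = sqrt (b\<^sup>2 - q\<^sup>2)"
  define \<gamma> where "\<gamma> = enorm m (g (u - x) - g (v - x))"
  have bounds: "0 \<le> p" "p \<le> a" "0 \<le> q" "q \<le> b" "a \<le> 3 * r" "b \<le> 3 * r" "0 \<le> \<gamma>" "0 \<le> \<eta>"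
    using g u v by (auto simp: a_def b_def p_def q_def \<gamma>_def \<eta>_def edist_eq)
  have eq: "(u - x) - (v - x) = u - v" by simp
  have \<gamma>1: "\<gamma> \<le> C * \<eta>" using Lip unfolding eq by (simp add: \<gamma>_def \<eta>_def edist_eq)
  have ab: "\<bar>a - b\<bar> \<le> \<eta>"
    using enorm_reverse_triangle[of d "u - x" "v - x"] unfolding eq by (simp add: a_def b_def \<eta>_def edist_eq)
  have pq: "\<bar>p - q\<bar> \<le> \<gamma>"
    unfolding p_def q_def \<gamma>_def by (rule enorm_reverse_triangle)
  have \<gamma>2: "\<gamma> \<le> p + q"
    using enorm_triangle[of m "g (u - x)" "- g (v - x)"] by (simp add: p_def q_def \<gamma>_def)
  have s: "0 \<le> s" "s\<^sup>2 = a\<^sup>2 - p\<^sup>2" and t: "0 \<le> t" "t\<^sup>2 = b\<^sup>2 - q\<^sup>2"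
    using power_mono[of p a 2] power_mono[of q b 2] bounds by (auto simp: s_def t_def)
  have "(s - t)\<^sup>2 = \<bar>s - t\<bar> * \<bar>s - t\<bar>" by (simp add: power2_eq_square)
  also have "\<dots> \<le> \<bar>s - t\<bar> * (s + t)" using s t by (intro mult_left_mono) auto
  also have "\<dots> = \<bar>(s - t) * (s + t)\<bar>"
    unfolding abs_mult using s(1) t(1) by simp
  also have "(s - t) * (s + t) = s\<^sup>2 - t\<^sup>2"
    by (simp add: power2_eq_square algebra_simps)
  also have "s\<^sup>2 - t\<^sup>2 = (a - b) * (a + b) - (p - q) * (p + q)"
    unfolding s t by (simp add: power2_eq_square algebra_simps)
  also have "\<bar>\<dots>\<bar> \<le> \<bar>a - b\<bar> * (a + b) + \<bar>p - q\<bar> * (p + q)"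
    using bounds abs_triangle_ineq4[of "(a - b) * (a + b)" "(p - q) * (p + q)"] by (simp add: abs_mult)
  also have "\<dots> \<le> \<eta> * (6 * r) + (C * \<eta>) * (6 * r)"
    using bounds ab pq \<gamma>1 C by (intro add_mono mult_mono) auto
  finally have st: "(s - t)\<^sup>2 \<le> \<eta> * (6 * r) + (C * \<eta>) * (6 * r)" .
  have "\<gamma>\<^sup>2 = \<gamma> * \<gamma>" by (simp add: power2_eq_square)
  also have "\<dots> \<le> (C * \<eta>) * (6 * r)"
    using \<gamma>1 \<gamma>2 bounds C by (intro mult_mono) auto
  finally have "\<gamma>\<^sup>2 + (s - t)\<^sup>2 \<le> 6 * r * (1 + 2 * C) * \<eta>" using st by (simp add: algebra_simps)
  moreover have "(edist (m + 1) (terminal_map d m R g x u) (terminal_map d m R g x v))\<^sup>2 = \<gamma>\<^sup>2 + (s - t)\<^sup>2"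
    unfolding edist_terminal_map_square
    by (simp add: \<gamma>_def s_def t_def a_def b_def p_def q_def mat_vec_diff)
  ultimately have "edist (m + 1) (terminal_map d m R g x u) (terminal_map d m R g x v)
      \<le> sqrt (6 * r * (1 + 2 * C) * \<eta>)"
    by (intro real_le_rsqrt) simp
  then show ?thesis
    using bounds by (simp add: real_sqrt_mult powr_half_sqrt \<eta>_def)
qed

section \<open>Nearest points and the assembled embedding\<close>

text \<open>Ties are broken by choice: the distortion bound holds for any nearest point, and only
  the local regularity relies on uniqueness.\<close>

definition nearest :: "nat \<Rightarrow> (nat \<Rightarrow> real) set \<Rightarrow> (nat \<Rightarrow> real) \<Rightarrow> nat \<Rightarrow> real" where
  "nearest d X u = (SOME x. x \<in> X \<and> (\<forall>y\<in>X. edist d u x \<le> edist d u y))"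

lemma nearest:
  assumes "finite X" "X \<noteq> {}"
  shows "nearest d X u \<in> X" "y \<in> X \<Longrightarrow> edist d u (nearest d X u) \<le> edist d u y"
proof -
  have "\<exists>x. x \<in> X \<and> (\<forall>y\<in>X. edist d u x \<le> edist d u y)"
    using ex_is_arg_min_if_finite[OF assms, of "edist d u"] by (auto simp: is_arg_min_linorder)
  then have "nearest d X u \<in> X \<and> (\<forall>y\<in>X. edist d u (nearest d X u) \<le> edist d u y)"
    unfolding nearest_def by (rule someI_ex)
  then show "nearest d X u \<in> X" "y \<in> X \<Longrightarrow> edist d u (nearest d X u) \<le> edist d u y" by auto
qed

lemma edist_commute: "edist d x y = edist d y x"
  by (simp add: edist_eq enorm_minus_commute)

lemma edist_triangle: "edist d x z \<le> edist d x y + edist d y z"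
  using enorm_triangle[of d "x - y" "y - z"] by (simp add: edist_eq)

lemma nearest_self:
  assumes "finite X" "X \<subseteq> euclid d" "x \<in> X"
  shows "nearest d X x = x"
proof -
  have ne: "X \<noteq> {}" using assms by auto
  have "edist d x (nearest d X x) \<le> edist d x x" by (rule nearest(2)[OF assms(1) ne assms(3)])
  then have "enorm d (x - nearest d X x) = 0"
    using enorm_nonneg[of d "x - nearest d X x"] by (simp add: edist_eq)
  then show ?thesis
    using euclid_eqI[of x d "nearest d X x"] assms nearest(1)[OF assms(1) ne, of d x] by (metis subsetD)
qed

text \<open>Uniqueness leaves a positive gap between the smallest distance and all others; a move of
  less than half this gap cannot change the minimiser.\<close>

lemma nearest_locally_constant:
  assumes X: "finite X" "X \<noteq> {}" and uniq: "unique_nearest d X u"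
  shows "\<exists>r>0. \<forall>v. edist d u v < r \<longrightarrow> nearest d X v = nearest d X u"
proof -
  define x where "x = nearest d X u"
  have x: "x \<in> X" "\<And>z. z \<in> X \<Longrightarrow> edist d u x \<le> edist d u z"
    unfolding x_def by (rule nearest[OF X])+
  have gap: "edist d u x < edist d u y" if y: "y \<in> X - {x}" for y
  proof (rule ccontr)
    assume "\<not> ?thesis"
    then have "y \<in> X \<and> (\<forall>z\<in>X. edist d u y \<le> edist d u z)"
      using y x(2) by force
    moreover have "x \<in> X \<and> (\<forall>z\<in>X. edist d u x \<le> edist d u z)"
      using x by blast
    ultimately have "x = y" using uniq unfolding unique_nearest_def by blast
    then show False using y by simp
  qed
  \<comment> \<open>The inserted 1 keeps \<open>Min\<close> on a nonempty set when \<open>X\<close>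
    is a singleton.\<close>
  define r where "r = Min (insert 1 ((\<lambda>y. (edist d u y - edist d u x) / 2) ` (X - {x})))"
  have r0: "0 < r" using X(1) gap by (simp add: r_def)
  have r: "2 * r \<le> edist d u y - edist d u x" if "y \<in> X - {x}" for y
  proof -
    have "r \<le> (edist d u y - edist d u x) / 2"
      unfolding r_def using X(1) that by (intro Min_le) auto
    then show ?thesis by simp
  qed
  have "nearest d X v = x" if v: "edist d u v < r" for v
  proof (rule ccontr)
    assume "nearest d X v \<noteq> x"
    then have y: "nearest d X v \<in> X - {x}" using nearest(1)[OF X] by blast
    have "edist d v (nearest d X v) \<le> edist d v x"
      by (rule nearest(2)[OF X x(1)])
    moreover have "edist d v x \<le> edist d u v + edist d u x"
      using edist_triangle[of d v x u] by (simp add: edist_commute[of d v u])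
    moreover have "edist d u (nearest d X v) \<le> edist d u v + edist d v (nearest d X v)"
      by (rule edist_triangle)
    ultimately show False using r[OF y] v by linarith
  qed
  then show ?thesis using r0 unfolding x_def by blast
qed

text \<open>Near \<open>u\<close> the base point \<open>x\<close> is constant, so a single formula
  applies. As \<open>u\<close> is not in \<open>X\<close>, \<open>v - x\<close> stays in an annulus
  from \<open>\<rho>\<close> to \<open>3 * \<rho>\<close>, where the selection is Lipschitz.\<close>

lemma locally_half_hoelder_terminal_map:
  assumes X: "finite X" "X \<subseteq> euclid d" and u: "u \<in> euclid d - X" and uniq: "unique_nearest d X u"
    and g: "\<And>x. x \<in> X \<Longrightarrow> terminal_selection d m R X \<delta> x (g x) (C x)"
  shows "locally_half_hoelder_at d (m + 1) (\<lambda>v. terminal_map d m R (g (nearest d X v)) (nearest d X v) v) u"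
proof -
  have ne: "X \<noteq> {}" using uniq by (auto simp: unique_nearest_def)
  define x where "x = nearest d X u"
  have x: "x \<in> X" unfolding x_def by (rule nearest(1)[OF X(1) ne])
  note sel = terminal_selectionD[OF g[OF x]]
  define \<rho> where "\<rho> = enorm d (u - x) / 2"
  have "enorm d (u - x) \<noteq> 0" using euclid_eqI[of u d x] u x X(2) by blast
  then have \<rho>: "0 < \<rho>" using enorm_nonneg[of d "u - x"] by (simp add: \<rho>_def less_le)
  obtain r where r: "0 < r" "\<And>v. edist d u v < r \<Longrightarrow> nearest d X v = x"
    using nearest_locally_constant[OF X(1) ne uniq] unfolding x_def by blast
  have near: "\<rho> \<le> enorm d (v - x) \<and> enorm d (v - x) \<le> 3 * \<rho>" if "edist d u v < min r \<rho>" for v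
    using that edist_triangle[of d u x v] edist_triangle[of d v x u]
    by (simp add: edist_commute[of d v u]) (simp add: edist_eq \<rho>_def)
  define D where "D = sqrt (6 * \<rho> * (1 + 2 * C x))"
  have D: "0 < D" using \<rho> sel(1) by (simp add: D_def add_pos_nonneg)
  show ?thesis
    unfolding locally_half_hoelder_at_def
  proof (intro exI conjI ballI impI)
    show "0 < min r \<rho>" using r \<rho> by simp
    show "0 < D" by (rule D)
    fix v w assume vw: "edist d u v < min r \<rho>" "edist d u w < min r \<rho>"
    then have n: "nearest d X v = x" "nearest d X w = x" using r(2) by auto
    show "edist (m + 1) (terminal_map d m R (g (nearest d X v)) (nearest d X v) v)
        (terminal_map d m R (g (nearest d X w)) (nearest d X w) w) \<le> D * edist d v w powr (1 / 2)"
      unfolding n D_def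
    proof (rule terminal_map_Hoelder[OF sel(1) \<rho> sel(2)])
      show "enorm m (g x (v - x) - g x (w - x)) \<le> C x * enorm d ((v - x) - (w - x))"
        using near[OF vw(1)] near[OF vw(2)] by (intro sel(4)[OF \<rho>]) blast+
    qed (use near[OF vw(1)] near[OF vw(2)] in blast)+
  qed
qed

text \<open>The factor 28 cancels, leaving relative error \<open>eps\<close> in squared distances.
  This suffices as \<open>(1 - eps)^2 \<le> 1 - eps\<close> and
  \<open>1 + eps \<le> (1 + eps)^2\<close>.\<close>

lemma terminal_embedding_terminal_map:
  assumes X: "finite X" "X \<noteq> {}" "X \<subseteq> euclid d" and eps: "0 < eps" "eps < 1"
    and lin: "\<And>x y. x \<in> X \<Longrightarrow> y \<in> X \<Longrightarrow>
        \<bar>dot m (mat_vec d R (x - y)) (mat_vec d R (x - y)) - dot d (x - y) (x - y)\<bar>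
        \<le> eps / 28 * dot d (x - y) (x - y)"
    and g: "\<And>x. x \<in> X \<Longrightarrow> terminal_selection d m R X (eps / 28) x (g x) (C x)"
  shows "terminal_embedding d (m + 1) X eps (\<lambda>v. terminal_map d m R (g (nearest d X v)) (nearest d X v) v)"
    (is "terminal_embedding _ _ _ _ ?f")
  unfolding terminal_embedding_def
proof (intro conjI ballI)
  show "?f y \<in> euclid (m + 1)" for y
    by (simp add: euclid_def terminal_map_def)
  fix x u assume x: "x \<in> X" and u: "u \<in> euclid d"
  define x0 where "x0 = nearest d X u"
  have x0: "x0 \<in> X" unfolding x0_def by (rule nearest(1)[OF X(1,2)])
  define E where "E = edist (m + 1) (?f x) (?f u)"
  define D where "D = edist d x u"
  have E0: "0 \<le> E" and D0: "0 \<le> D" by (simp_all add: E_def D_def edist_eq)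
  have "\<bar>E\<^sup>2 - D\<^sup>2\<bar> \<le> 28 * (eps / 28) * D\<^sup>2"
    unfolding E_def D_def nearest_self[OF X(1,3) x] x0_def[symmetric]
  proof (rule terminal_map_distortion)
    show "0 \<le> eps / 28" using eps by simp
    show "enorm d (u - x0) \<le> enorm d (x - u)"
      using nearest(2)[OF X(1,2) x, of d u]
      unfolding x0_def[symmetric] edist_eq enorm_minus_commute[of d x u] .
  qed (rule terminal_selectionD(2)[OF g[OF x0]] terminal_selectionD(2)[OF g[OF x]] lin[OF x x0]
      terminal_selectionD(3)[OF g[OF x0] x])+
  then have ED: "\<bar>E\<^sup>2 - D\<^sup>2\<bar> \<le> eps * D\<^sup>2" by simp
  have "(1 - eps) * (1 - eps) \<le> 1 * (1 - eps)"
    by (rule mult_right_mono) (use eps in auto)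
  then have "((1 - eps) * D)\<^sup>2 \<le> (1 - eps) * D\<^sup>2"
    unfolding power_mult_distrib power2_eq_square[of "1 - eps"] by (intro mult_right_mono) simp_all
  also have "\<dots> \<le> E\<^sup>2" using ED by (simp add: left_diff_distrib)
  finally show "(1 - eps) * D \<le> E" using E0 by (rule power2_le_imp_le)
  have "1 * (1 + eps) \<le> (1 + eps) * (1 + eps)"
    by (rule mult_right_mono) (use eps in auto)
  then have "(1 + eps) * D\<^sup>2 \<le> ((1 + eps) * D)\<^sup>2"
    unfolding power_mult_distrib power2_eq_square[of "1 + eps"] by (intro mult_right_mono) simp_all
  moreover have "E\<^sup>2 \<le> (1 + eps) * D\<^sup>2" using ED by (simp add: distrib_right)
  ultimately have "E\<^sup>2 \<le> ((1 + eps) * D)\<^sup>2" by linarith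
  moreover have "0 \<le> (1 + eps) * D" using D0 eps by simp
  ultimately show "E \<le> (1 + eps) * D" by (rule power2_le_imp_le)
qed

lemma locally_half_hoelder_at_0: "locally_half_hoelder_at 0 k f u"
  by (auto simp: locally_half_hoelder_at_def euclid_def edist_eq intro!: exI[of _ 1])

theorem theorem1:
  shows "\<exists>c>0. \<forall>d::nat. \<forall>X eps.
     finite X \<and> X \<noteq> {} \<and> X \<subseteq> euclid d \<and> 0 < eps \<and> eps < 1 \<longrightarrow>
     (\<exists>(m::nat) f.
        real m \<le> c * eps powr (-2) * ln (real (card X)) \<and>
        terminal_embedding d (m + 1) X eps f \<and>
        (AE u in lebesgue_d d. locally_half_hoelder_at d (m + 1) f u) \<and>
        (\<forall>u\<in>euclid d - X. unique_nearest d X u \<longrightarrow> locally_half_hoelder_at d (m + 1) f u))"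
proof (rule exI[of _ "66 * 28\<^sup>2"], intro conjI allI impI)
  fix d :: nat and X and eps :: real
  assume A: "finite X \<and> X \<noteq> {} \<and> X \<subseteq> euclid d \<and> 0 < eps \<and> eps < 1"
  then have X: "finite X" "X \<noteq> {}" "X \<subseteq> euclid d" and eps: "0 < eps" "eps < 1" by auto
  \<comment> \<open>Compensates the factor 28 of the distortion estimate; with the 66 in the bound
    on \<open>m\<close> this gives the constant \<open>66 * 28^2\<close>, uniformly in
    \<open>d\<close>.\<close>
  define \<delta> where "\<delta> = eps / 28"
  have \<delta>: "0 < \<delta>" "\<delta> < 1" using eps by (auto simp: \<delta>_def)
  obtain m R where m: "real m \<le> 66 * ln (real (card X)) / \<delta>\<^sup>2"
    and lin: "\<And>x y. x \<in> X \<Longrightarrow> y \<in> X \<Longrightarrow>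
        \<bar>dot m (mat_vec d R (x - y)) (mat_vec d R (x - y)) - dot d (x - y) (x - y)\<bar>
        \<le> \<delta> * dot d (x - y) (x - y)"
    and hull: "\<And>x0 c. x0 \<in> X \<Longrightarrow>
        enorm d (\<Sum>x\<in>X - {x0}. c x *\<^sub>R ((1 / enorm d (x - x0)) *\<^sub>R (x - x0)))
        \<le> enorm m (mat_vec d R (\<Sum>x\<in>X - {x0}. c x *\<^sub>R ((1 / enorm d (x - x0)) *\<^sub>R (x - x0))))
          + 5 * \<delta> * (\<Sum>x\<in>X - {x0}. \<bar>c x\<bar>)"
    using distortion_matrix_exists[OF X \<delta>] by blast
  have "\<exists>g C. terminal_selection d m R X \<delta> x g C" if "x \<in> X" for x
    by (rule terminal_selection_exists[OF X(1,3) \<delta>(1) that hull[OF that]])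
  then obtain g C where g: "\<And>x. x \<in> X \<Longrightarrow> terminal_selection d m R X \<delta> x (g x) (C x)"
    by metis
  define f where "f = (\<lambda>v. terminal_map d m R (g (nearest d X v)) (nearest d X v) v)"
  have "66 * ln (real (card X)) / \<delta>\<^sup>2 = 66 * 28\<^sup>2 * eps powr (-2) * ln (real (card X))"
  proof -
    have "eps powr (-2) = 1 / eps\<^sup>2" using eps powr_minus_divide[of eps 2] by simp
    then show ?thesis unfolding \<delta>_def power_divide by simp
  qed
  then have 1: "real m \<le> 66 * 28\<^sup>2 * eps powr (-2) * ln (real (card X))" using m by simp
  have 2: "terminal_embedding d (m + 1) X eps f"
    unfolding f_def
    by (rule terminal_embedding_terminal_map[OF X eps lin[unfolded \<delta>_def] g[unfolded \<delta>_def]])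
  have 3: "locally_half_hoelder_at d (m + 1) f u" if "u \<in> euclid d - X" "unique_nearest d X u" for u
    unfolding f_def by (rule locally_half_hoelder_terminal_map[OF X(1,3) that g])
  have 4: "AE u in lebesgue_d d. locally_half_hoelder_at d (m + 1) f u"
  proof (cases "d = 0")
    \<comment> \<open>In dimension 0 no point lies outside \<open>X\<close>, but the space is a
      single point, where every map is Hoelder.\<close>
    case True
    then show ?thesis by (simp add: locally_half_hoelder_at_0)
  next
    case False
    then have "AE u in lebesgue_d d. u \<in> euclid d - X \<and> unique_nearest d X u"
      by (intro AE_unique_nearest X) simp
    then show ?thesis
    proof eventually_elim
      case (elim u)
      then show ?case using 3 by blast
    qed
  qed
  show "\<exists>(m::nat) f.
        real m \<le> 66 * 28\<^sup>2 * eps powr (-2) * ln (real (card X)) \<and>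
        terminal_embedding d (m + 1) X eps f \<and>
        (AE u in lebesgue_d d. locally_half_hoelder_at d (m + 1) f u) \<and>
        (\<forall>u\<in>euclid d - X. unique_nearest d X u \<longrightarrow> locally_half_hoelder_at d (m + 1) f u)"
    using 1 2 3 4 by blast
qed simp

end
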